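(* Let $\zeta(s,a)$ denote the Hurwitz zeta-function. (1) For every real $a$ with $0<a<1/2$, the function $\sigma\mapsto\zeta(\sigma,a)$ has precisely one zero in the open interval $(0,1)$, and this zero is simple. (2) For $0<a<1/2$, let $\beta(a)$ denote the unique zero of $\zeta(\sigma,a)$ in $(0,1)$. Then $\beta:(0,1/2)\to(0,1)$ is a strictly decreasing $C^\infty$-diffeomorphism. Moreover, the asymptotic formula \[ \beta(a)=1-a+a^2\log a+O(a^2)\quad\text{as } a\to0+ \] holds.
   Context: For $0<a\le1$, the Hurwitz zeta-function is defined by $\zeta(s,a)=\sum_{n=0}^\infty(n+a)^{-s}$ for complex $s=\sigma+it$ with $\sigma>1$, and is extended by meromorphic continuation to the whole complex plane, with only a simple pole of residue $1$ at $s=1$. For $0<\sigma<1$, $\zeta(\sigma,a)$ denotes the value of this continuation at the real point $s=\sigma$. *)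

theory Defs
  imports "HOL-Complex_Analysis.Complex_Analysis" "HOL-Library.Landau_Symbols"
begin

text \<open>
  The Hurwitz zeta function with parameter \<open>a\<close> (meant for \<open>0 < a \<le> 1\<close>) is the analytic
  continuation of its Dirichlet series to the complex plane without the point \<open>1\<close>. The
  continuation is unique because that region is connected. At \<open>1\<close> it has a simple pole, where
  we use the conventional value \<open>0\<close> so that the function is determined everywhere.
\<close>

definition hurwitz_zeta :: "real \<Rightarrow> complex \<Rightarrow> complex" where
  "hurwitz_zeta a = (THE f.
     f holomorphic_on (- {1}) \<and>
     (\<forall>s. Re s > 1 \<longrightarrow> f s = (\<Sum>n. (of_nat n + of_real a) powr (- s))) \<and>
     f 1 = 0)"

definition hurwitz_beta :: "real \<Rightarrow> real" where
  "hurwitz_beta a = (THE \<sigma>. \<sigma> \<in> {0<..<1} \<and> hurwitz_zeta a (of_real \<sigma>) = 0)"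

text \<open>
  On an open set \<open>S\<close> the values of the iterated derivatives at points of \<open>S\<close> depend only on
  \<open>f\<close> near those points, so values of \<open>f\<close> outside \<open>S\<close> are irrelevant. Continuity of all
  derivatives on \<open>S\<close> follows from their differentiability.
\<close>

definition smooth_on :: "real set \<Rightarrow> (real \<Rightarrow> real) \<Rightarrow> bool" where
  "smooth_on S f \<longleftrightarrow>
     open S \<and> (\<forall>k. \<forall>x\<in>S. (deriv ^^ k) f field_differentiable (at x))"

definition smooth_diffeomorphism :: "(real \<Rightarrow> real) \<Rightarrow> real set \<Rightarrow> real set \<Rightarrow> bool" where
  "smooth_diffeomorphism f S T \<longleftrightarrow>
     bij_betw f S T \<and> smooth_on S f \<and> smooth_on T (inv_into S f)"

end

theory Submission
  imports Defs "HOL-Real_Asymp.Real_Asymp"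
begin

text \<open>
  For \<open>0 < s < 1\<close> the product \<open>\<Gamma>(s) \<zeta>(s, a)\<close> is the Mellin transform of
  \<open>H(x) = exp (- a x) / (1 - exp (- x)) - 1 / x\<close>. If \<open>0 < a < 1/2\<close>, then \<open>H\<close> changes sign exactly
  once, from positive to negative, at some \<open>d\<close>. Hence \<open>d powr (- s) \<Gamma>(s) \<zeta>(s, a)\<close>, the integral of
  \<open>H(x) (x / d) powr s / x\<close>, decreases in \<open>s\<close> with slope bounded away from \<open>0\<close>, so there is at most one
  zero in \<open>(0, 1)\<close> and it is simple. It exists because \<open>(s - 1) \<zeta>(s, a)\<close> is \<open>a - 1/2 < 0\<close> at \<open>s = 0\<close>
  and \<open>1\<close> at \<open>s = 1\<close>. The kernel \<open>H\<close> also decreases in \<open>a\<close>, so both partial derivatives are nonzero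
  on the zero set, and the implicit function theorem gives smoothness in both directions. Near
  \<open>a = 0\<close>, the equation \<open>\<zeta>(s, a) = a powr (- s) + \<zeta>(s, a + 1)\<close> turns \<open>\<delta> = 1 - \<beta>(a)\<close> into the fixed
  point \<open>\<delta> = a powr (1 - \<delta>) (1 + O(\<delta>))\<close>.
\<close>


section \<open>Separately holomorphic functions of two variables\<close>


text \<open>For each \<open>a\<close> separately, \<open>hurwitz_zeta\<close> is fixed by
  continuation in \<open>s\<close> alone, which says nothing about its dependence on
  \<open>a\<close>. The continuation is therefore built in both variables at once, as a continuous
  function holomorphic in each of them. Cauchy's integral formula closes this class under both
  partial derivatives, so one derivative of the zero yields all of them: each further derivative is
  again such a function evaluated along the curve of zeros. Strict monotonicity alone would allow a
  vanishing derivative; the integral comparisons therefore bound difference quotients away from 0,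
  using one compact window of the integral, and the bounds pass to the partial derivatives without
  differentiating the Mellin integral. Monotonicity also supplies continuity of the zero, so the
  implicit function argument only differentiates a solution that is already known. Near
  \<open>a = 0\<close> the logarithm comes from the first order term of
  \<open>exp (\<delta> * (- ln a))\<close> at \<open>\<delta> = a + ...\<close>.\<close>

lemma continuous_on_deriv_param:
  fixes f :: "complex \<times> 'b::metric_space \<Rightarrow> complex"
  assumes U: "open U" and cont: "continuous_on (U \<times> T) f"
    and hol: "\<And>t. t \<in> T \<Longrightarrow> (\<lambda>z. f (z, t)) holomorphic_on U"
  shows "continuous_on (U \<times> T) (\<lambda>(z, t). deriv (\<lambda>z. f (z, t)) z)"
  unfolding continuous_on_eq_continuous_within
proof
  fix p assume "p \<in> U \<times> T"
  then obtain z0 t0 where p: "p = (z0, t0)" "z0 \<in> U" "t0 \<in> T" by auto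
  obtain r where r: "r > 0" "cball z0 r \<subseteq> U" using U p open_contains_cball by blast
  have circ: "circlepath z0 r x \<in> U" "x \<in> {0..1} \<Longrightarrow> z \<in> ball z0 r \<Longrightarrow> circlepath z0 r x \<noteq> z" for x z
  proof -
    have *: "dist z0 (circlepath z0 r x) = r"
      using r by (simp add: circlepath dist_norm norm_mult)
    show "circlepath z0 r x \<in> U" using * r by auto
    show "x \<in> {0..1} \<Longrightarrow> z \<in> ball z0 r \<Longrightarrow> circlepath z0 r x \<noteq> z" using * by auto
  qed
  \<comment> \<open>On a circle around \<open>z0\<close> that serves all nearby \<open>z\<close> and
    all \<open>t\<close>, Cauchy's formula expresses the derivative through values of
    \<open>f\<close> alone, so continuity in \<open>t\<close> is enough.\<close>
  have eq: "deriv (\<lambda>z. f (z, t)) z =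
      1 / (2 * of_real pi * \<i>) * integral (cbox 0 1) (\<lambda>x. f (circlepath z0 r x, t) / (circlepath z0 r x - z)^2 *
         (2 * pi * \<i> * r * exp (2 * of_real pi * \<i> * x)))"
    if "z \<in> ball z0 r" "t \<in> T" for z t
  proof -
    have h: "(\<lambda>z. f (z, t)) holomorphic_on U" by (rule hol[OF that(2)])
    have "continuous_on (cball z0 r) (\<lambda>z. f (z, t))" 
      using h r holomorphic_on_imp_continuous_on holomorphic_on_subset by blast
    moreover have "(\<lambda>z. f (z, t)) holomorphic_on ball z0 r"
      using h r ball_subset_cball holomorphic_on_subset by blast
    ultimately have "((\<lambda>z. f (z, t)) has_field_derivative (1 / (2 * of_real pi * \<i>) * contour_integral(circlepath z0 r) (\<lambda>u. f (u,t) / (u-z)^2))) (at z)"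
      by (rule Cauchy_derivative_integral_circlepath) (use that in auto)
    then show ?thesis
      by (simp add: DERIV_imp_deriv contour_integral_integral vector_derivative_circlepath)
  qed
  have c1: "continuous_on ((ball z0 r \<times> T) \<times> cbox 0 1) (\<lambda>(q, x). f (circlepath z0 r x, snd q) / (circlepath z0 r x - fst q)^2 *
         (2 * pi * \<i> * r * exp (2 * of_real pi * \<i> * of_real x)))"
    unfolding split_beta
  proof (intro continuous_intros)
    have *: "continuous_on ((ball z0 r \<times> T) \<times> cbox 0 1) (\<lambda>p. circlepath z0 r (snd p))"
      unfolding circlepath by (intro continuous_intros)
    then show "continuous_on ((ball z0 r \<times> T) \<times> cbox 0 1) (\<lambda>p. circlepath z0 r (snd p))" .
    show "continuous_on ((ball z0 r \<times> T) \<times> cbox 0 1) (\<lambda>p. f (circlepath z0 r (snd p), snd (fst p)))"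
      by (rule continuous_on_compose2[OF cont]) (intro continuous_intros *, use circ in auto)
  qed (use circ in fastforce)
  have "continuous_on (ball z0 r \<times> T) (\<lambda>q. integral (cbox 0 1) (\<lambda>x. f (circlepath z0 r x, snd q) / (circlepath z0 r x - fst q)^2 *
         (2 * pi * \<i> * r * exp (2 * of_real pi * \<i> * of_real x))))"
    by (rule integral_continuous_on_param[OF c1])
  then have "continuous_on (ball z0 r \<times> T) (\<lambda>q. 1 / (2 * of_real pi * \<i>) * integral (cbox 0 1) (\<lambda>x. f (circlepath z0 r x, snd q) / (circlepath z0 r x - fst q)^2 *
         (2 * pi * \<i> * r * exp (2 * of_real pi * \<i> * of_real x))))"
    by (intro continuous_on_mult_left)
  then have "continuous_on (ball z0 r \<times> T) (\<lambda>(z, t). deriv (\<lambda>z. f (z, t)) z)"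
    by (rule continuous_on_eq) (auto simp: eq)
  then have "continuous (at p within ball z0 r \<times> T) (\<lambda>(z, t). deriv (\<lambda>z. f (z, t)) z)"
    using p r by (auto simp: continuous_on_eq_continuous_within)
  moreover have "at p within ball z0 r \<times> T = at p within U \<times> T"
    by (rule at_within_nhd[of _ "ball z0 r \<times> UNIV"])
      (use p r in \<open>auto intro!: open_Times simp: subset_eq\<close>)
  ultimately show "continuous (at p within U \<times> T) (\<lambda>(z, t). deriv (\<lambda>z. f (z, t)) z)"
    by simp
qed

text \<open>The Leibniz rule asks for joint continuity of the derivative of the integrand, which
  Cauchy's formula has just provided. It is applied on balls because it needs a convex
  domain.\<close>

lemma holomorphic_on_integral_param:
  fixes f :: "complex \<times> real \<Rightarrow> complex"
  assumes U: "open U" and cont: "continuous_on (U \<times> {a..b}) f"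
    and hol: "\<And>t. t \<in> {a..b} \<Longrightarrow> (\<lambda>z. f (z, t)) holomorphic_on U"
  shows "(\<lambda>z. integral {a..b} (\<lambda>t. f (z, t))) holomorphic_on U"
proof -
  have "(\<lambda>z. integral {a..b} (\<lambda>t. f (z, t))) field_differentiable at z0 within U" if z0: "z0 \<in> U" for z0
  proof -
    obtain r where r: "r > 0" "ball z0 r \<subseteq> U" using openE[OF U z0] by metis
    have "(\<lambda>z. integral (cbox a b) (\<lambda>t. f (z, t))) holomorphic_on (ball z0 r)"
    proof (rule leibniz_rule_holomorphic)
      show "((\<lambda>x. f (x, t)) has_field_derivative deriv (\<lambda>z. f (z, t)) x) (at x within ball z0 r)"
        if "x \<in> ball z0 r" "t \<in> cbox a b" for x t
        using that r hol[of t] U by (intro has_field_derivative_at_within[OF holomorphic_derivI[of _ U]]) auto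
      show "(\<lambda>t. f (z, t)) integrable_on cbox a b" if "z \<in> ball z0 r" for z
        using that r
        by (intro integrable_continuous continuous_on_compose2[OF cont] continuous_intros) auto
      show "continuous_on (ball z0 r \<times> cbox a b) (\<lambda>(x, t). deriv (\<lambda>z. f (z, t)) x)"
        by (rule continuous_on_subset[OF continuous_on_deriv_param[OF U cont hol]]) (use r in auto)
    qed auto
    then have "(\<lambda>z. integral {a..b} (\<lambda>t. f (z, t))) field_differentiable at z0"
      using r by (simp add: holomorphic_on_imp_differentiable_at)
    then show ?thesis by (rule field_differentiable_at_within)
  qed
  then show ?thesis by (auto simp: holomorphic_on_def)
qed

text \<open>By Osgood's lemma this is holomorphy in two variables. Joint continuity is what makes
  Cauchy integrals in one variable well behaved in the other.\<close>

definition sep_hol :: "(complex \<times> complex) set \<Rightarrow> (complex \<times> complex \<Rightarrow> complex) \<Rightarrow> bool" where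
  "sep_hol W f \<longleftrightarrow> open W \<and> continuous_on W f \<and>
     (\<forall>s w. (s, w) \<in> W \<longrightarrow> (\<lambda>z. f (z, w)) field_differentiable at s \<and>
                          (\<lambda>z. f (s, z)) field_differentiable at w)"

definition partial_fst :: "(complex \<times> complex \<Rightarrow> complex) \<Rightarrow> complex \<times> complex \<Rightarrow> complex" where
  "partial_fst f p = deriv (\<lambda>z. f (z, snd p)) (fst p)"

definition partial_snd :: "(complex \<times> complex \<Rightarrow> complex) \<Rightarrow> complex \<times> complex \<Rightarrow> complex" where
  "partial_snd f p = deriv (\<lambda>z. f (fst p, z)) (snd p)"

lemma sep_hol_box:
  assumes "sep_hol W f" "U \<times> V \<subseteq> W" "open U" "open V"
  shows "w \<in> V \<Longrightarrow> (\<lambda>z. f (z, w)) holomorphic_on U"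
    "s \<in> U \<Longrightarrow> (\<lambda>z. f (s, z)) holomorphic_on V" "continuous_on (U \<times> V) f"
proof -
  have *: "(s, w) \<in> W" if "s \<in> U" "w \<in> V" for s w using assms that by auto
  show "w \<in> V \<Longrightarrow> (\<lambda>z. f (z, w)) holomorphic_on U"
    using assms(1) * unfolding holomorphic_on_def sep_hol_def
    by (blast intro: field_differentiable_at_within)
  show "s \<in> U \<Longrightarrow> (\<lambda>z. f (s, z)) holomorphic_on V"
    using assms(1) * unfolding holomorphic_on_def sep_hol_def
    by (blast intro: field_differentiable_at_within)
  show "continuous_on (U \<times> V) f"
    using assms(1,2) unfolding sep_hol_def by (metis continuous_on_subset)
qed

lemma open_box:
  fixes W :: "('a::metric_space \<times> 'b::metric_space) set"
  assumes "open W" "(s, w) \<in> W"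
  obtains r where "r > 0" "ball s r \<times> ball w r \<subseteq> W"
proof -
  obtain A B where AB: "open A" "open B" "(s, w) \<in> A \<times> B" "A \<times> B \<subseteq> W"
    using assms open_prod_elim by blast
  obtain r1 r2 where "r1 > 0" "ball s r1 \<subseteq> A" "r2 > 0" "ball w r2 \<subseteq> B"
    using AB open_contains_ball by (metis mem_Sigma_iff)
  then have "ball s (min r1 r2) \<times> ball w (min r1 r2) \<subseteq> W" "min r1 r2 > 0"
    using AB by (auto simp: subset_eq)
  then show ?thesis using that by blast
qed

lemma sep_hol_subset: "sep_hol W f \<Longrightarrow> W' \<subseteq> W \<Longrightarrow> open W' \<Longrightarrow> sep_hol W' f"
  unfolding sep_hol_def by (metis continuous_on_subset subsetD)

lemma sep_hol_local:
  assumes "\<And>p. p \<in> W \<Longrightarrow> \<exists>W'. p \<in> W' \<and> W' \<subseteq> W \<and> sep_hol W' f"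
  shows "sep_hol W f"
proof -
  have "\<exists>T. open T \<and> p \<in> T \<and> T \<subseteq> W" if "p \<in> W" for p
    using assms[OF that] unfolding sep_hol_def by metis
  then have o: "open W" by (subst open_subopen) auto
  moreover have "continuous_on W f"
    unfolding continuous_on_eq_continuous_at[OF o]
  proof
    fix p assume "p \<in> W"
    then obtain W' where "p \<in> W'" "sep_hol W' f" using assms by metis
    then show "isCont f p" unfolding sep_hol_def using continuous_on_eq_continuous_at by metis
  qed
  moreover have "(\<lambda>z. f (z, w)) field_differentiable at s \<and> (\<lambda>z. f (s, z)) field_differentiable at w"
    if "(s, w) \<in> W" for s w
    using assms[OF that] unfolding sep_hol_def by metis
  ultimately show ?thesis unfolding sep_hol_def by auto
qed

lemma sep_hol_cong:
  assumes "sep_hol W f" "\<And>p. p \<in> W \<Longrightarrow> f p = g p"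
  shows "sep_hol W g"
  unfolding sep_hol_def
proof (intro conjI allI impI)
  show o: "open W" using assms by (simp add: sep_hol_def)
  show "continuous_on W g" using assms by (auto simp: sep_hol_def cong: continuous_on_cong)
  fix s w assume sw: "(s, w) \<in> W"
  obtain r where r: "r > 0" "ball s r \<times> ball w r \<subseteq> W" using open_box[OF o sw] .
  have f: "(\<lambda>z. f (z, w)) field_differentiable at s" "(\<lambda>z. f (s, z)) field_differentiable at w"
    using assms(1) sw by (auto simp: sep_hol_def)
  have eq: "f (z, w) = g (z, w)" if "dist z s < r" for z
    using that r by (intro assms(2)) (auto simp: dist_commute subset_eq)
  show "(\<lambda>z. g (z, w)) field_differentiable at s"
    by (rule field_differentiable_transform_within[OF r(1) _ _ f(1)]) (auto intro: eq)
  have eq: "f (s, z) = g (s, z)" if "dist z w < r" for z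
    using that r by (intro assms(2)) (auto simp: dist_commute subset_eq)
  show "(\<lambda>z. g (s, z)) field_differentiable at w"
    by (rule field_differentiable_transform_within[OF r(1) _ _ f(2)]) (auto intro: eq)
qed

lemma sep_hol_swap:
  assumes "sep_hol W f"
  shows "sep_hol (prod.swap -` W) (f \<circ> prod.swap)"
proof -
  have "continuous_on (prod.swap -` W) (\<lambda>p. f (prod.swap p))"
    using assms unfolding sep_hol_def
    by (intro continuous_on_compose2[of W f _ prod.swap]) (auto intro: continuous_on_swap)
  moreover have "open (prod.swap -` W)"
    using assms unfolding sep_hol_def by (intro open_vimage continuous_on_swap) auto
  ultimately show ?thesis using assms unfolding sep_hol_def by (auto simp: o_def)
qed

text \<open>In the first variable this is the holomorphy of a derivative. In the second, Cauchy's
  formula in the first variable turns the partial derivative into an integral over a circle of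
  functions holomorphic in \<open>w\<close>, hence into a holomorphic function of
  \<open>w\<close>.\<close>

lemma sep_hol_partial_fst:
  assumes "sep_hol W f"
  shows "sep_hol W (partial_fst f)"
proof (rule sep_hol_local)
  fix p assume p: "p \<in> W"
  obtain s0 w0 where p': "p = (s0, w0)" by (cases p)
  have o: "open W" using assms by (simp add: sep_hol_def)
  obtain r where r: "r > 0" "ball s0 r \<times> ball w0 r \<subseteq> W" using open_box[OF o] p p' by metis
  define r' where "r' = r / 2"
  have r': "r' > 0" "r' < r" "cball s0 r' \<subseteq> ball s0 r" using r by (auto simp: r'_def)
  let ?V = "ball w0 r"
  have hol1: "(\<lambda>z. f (z, w)) holomorphic_on ball s0 r" if "w \<in> ?V" for w
    using sep_hol_box(1)[OF assms r(2)] that by simp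
  have hol2: "(\<lambda>z. f (s, z)) holomorphic_on ?V" if "s \<in> ball s0 r" for s
    using sep_hol_box(2)[OF assms r(2)] that by simp
  have cont: "continuous_on (ball s0 r \<times> ?V) f" 
    using sep_hol_box(3)[OF assms r(2)] by simp
  have "continuous_on (ball s0 r \<times> ?V) (\<lambda>(z, t). deriv (\<lambda>z. f (z, t)) z)"
    by (rule continuous_on_deriv_param) (use cont hol1 in auto)
  then have c: "continuous_on (ball s0 r \<times> ?V) (partial_fst f)" by (simp add: partial_fst_def[abs_def] split_beta)
  have circ: "circlepath s0 r' x \<in> ball s0 r" "x \<in> {0..1} \<Longrightarrow> z \<in> ball s0 r' \<Longrightarrow> circlepath s0 r' x \<noteq> z" for x z
  proof -
    have *: "dist s0 (circlepath s0 r' x) = r'"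
      using r' by (simp add: circlepath dist_norm norm_mult)
    show "circlepath s0 r' x \<in> ball s0 r" using * r' by auto
    show "x \<in> {0..1} \<Longrightarrow> z \<in> ball s0 r' \<Longrightarrow> circlepath s0 r' x \<noteq> z" using * by auto
  qed
  have h1: "(\<lambda>z. partial_fst f (z, w)) holomorphic_on ball s0 r'" if "w \<in> ?V" for w
    using holomorphic_deriv[OF hol1[OF that]] r'
    by (auto simp: partial_fst_def intro: holomorphic_on_subset)
  have h2: "(\<lambda>z. partial_fst f (s, z)) holomorphic_on ?V" if s: "s \<in> ball s0 r'" for s
  proof -
    let ?h = "\<lambda>(w, x). f (circlepath s0 r' x, w) / (circlepath s0 r' x - s)^2 *
         (2 * pi * \<i> * r' * exp (2 * of_real pi * \<i> * complex_of_real x))"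
    have "(\<lambda>w. integral {0..1} (\<lambda>x. ?h (w, x))) holomorphic_on ?V"
    proof (rule holomorphic_on_integral_param)
      show "continuous_on (?V \<times> {0..1}) ?h"
        unfolding split_beta
      proof (intro continuous_intros)
        have *: "continuous_on (?V \<times> {0..1}) (\<lambda>p. circlepath s0 r' (snd p))"
          unfolding circlepath by (intro continuous_intros)
        then show "continuous_on (?V \<times> {0..1}) (\<lambda>p. circlepath s0 r' (snd p))" .
        show "continuous_on (?V \<times> {0..1}) (\<lambda>p. f (circlepath s0 r' (snd p), fst p))"
          by (rule continuous_on_compose2[OF cont]) (intro continuous_intros *, use circ in auto)
      qed (use circ s in fastforce)
      show "(\<lambda>w. ?h (w, t)) holomorphic_on ?V" if "t \<in> {0..1}" for t
        unfolding split using circ s that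
        by (intro holomorphic_intros hol2) auto
    qed simp
    then have "(\<lambda>w. 1 / (2 * of_real pi * \<i>) * integral {0..1} (\<lambda>x. ?h (w, x))) holomorphic_on ?V"
      by (intro holomorphic_intros) auto
    then show ?thesis
    proof (rule holomorphic_transform)
      fix w assume w: "w \<in> ?V"
      have h: "(\<lambda>z. f (z, w)) holomorphic_on ball s0 r" by (rule hol1[OF w])
      have "continuous_on (cball s0 r') (\<lambda>z. f (z, w))" 
        using h r' holomorphic_on_imp_continuous_on holomorphic_on_subset by blast
      moreover have "(\<lambda>z. f (z, w)) holomorphic_on ball s0 r'"
        using h r' ball_subset_cball holomorphic_on_subset by blast
      ultimately have "((\<lambda>z. f (z, w)) has_field_derivative (1 / (2 * of_real pi * \<i>) * contour_integral(circlepath s0 r') (\<lambda>u. f (u,w) / (u-s)^2))) (at s)"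
        by (rule Cauchy_derivative_integral_circlepath) (use s in auto)
      then show "1 / (2 * of_real pi * \<i>) * integral {0..1} (\<lambda>x. ?h (w, x)) = partial_fst f (s, w)"
        by (simp add: partial_fst_def DERIV_imp_deriv contour_integral_integral vector_derivative_circlepath)
    qed
  qed
  have "sep_hol (ball s0 r' \<times> ?V) (partial_fst f)"
    unfolding sep_hol_def
  proof (intro conjI allI impI)
    show "open (ball s0 r' \<times> ?V)" by (simp add: open_Times)
    show "continuous_on (ball s0 r' \<times> ?V) (partial_fst f)" using c r' by (rule_tac continuous_on_subset) auto
  next
    fix s w assume "(s, w) \<in> ball s0 r' \<times> ?V"
    then show "(\<lambda>z. partial_fst f (z, w)) field_differentiable at s" "(\<lambda>z. partial_fst f (s, z)) field_differentiable at w"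
      using holomorphic_on_imp_differentiable_at[OF h1] holomorphic_on_imp_differentiable_at[OF h2] by auto
  qed
  then show "\<exists>W'. p \<in> W' \<and> W' \<subseteq> W \<and> sep_hol W' (partial_fst f)"
    using r r' p' by (intro exI[of _ "ball s0 r' \<times> ?V"]) auto
qed

lemma sep_hol_partial_snd:
  assumes "sep_hol W f"
  shows "sep_hol W (partial_snd f)"
proof -
  have "sep_hol (prod.swap -` (prod.swap -` W)) (partial_fst (f \<circ> prod.swap) \<circ> prod.swap)"
    by (intro sep_hol_swap sep_hol_partial_fst assms)
  moreover have "prod.swap -` (prod.swap -` W) = W" by auto
  moreover have "partial_fst (f \<circ> prod.swap) \<circ> prod.swap = partial_snd f"
    by (auto simp: partial_fst_def partial_snd_def fun_eq_iff)
  ultimately show ?thesis by simp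
qed

lemma sep_hol_add: "sep_hol W f \<Longrightarrow> sep_hol W g \<Longrightarrow> sep_hol W (\<lambda>p. f p + g p)"
  unfolding sep_hol_def by (intro conjI allI impI continuous_on_add field_differentiable_add) auto

lemma sep_hol_mult: "sep_hol W f \<Longrightarrow> sep_hol W g \<Longrightarrow> sep_hol W (\<lambda>p. f p * g p)"
  unfolding sep_hol_def by (intro conjI allI impI continuous_on_mult field_differentiable_mult) auto

lemma sep_hol_uminus: "sep_hol W f \<Longrightarrow> sep_hol W (\<lambda>p. - f p)"
  unfolding sep_hol_def by (intro conjI allI impI continuous_on_minus field_differentiable_minus) auto

lemma sep_hol_divide:
  "sep_hol W f \<Longrightarrow> sep_hol W g \<Longrightarrow> (\<And>p. p \<in> W \<Longrightarrow> g p \<noteq> 0) \<Longrightarrow> sep_hol W (\<lambda>p. f p / g p)"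
  unfolding sep_hol_def by (intro conjI allI impI continuous_on_divide field_differentiable_divide) auto

lemma sep_hol_const: "open W \<Longrightarrow> sep_hol W (\<lambda>_. c)"
  unfolding sep_hol_def by simp

lemma sep_hol_fst: "open W \<Longrightarrow> sep_hol W fst" and sep_hol_snd: "open W \<Longrightarrow> sep_hol W snd"
  unfolding sep_hol_def by (simp_all add: continuous_on_fst continuous_on_snd field_differentiable_ident)

text \<open>Existence of both partial derivatives is weaker than total differentiability; continuity
  of one of them, here the second, closes the gap.\<close>

lemma sep_hol_has_derivative:
  assumes "sep_hol W f" "p \<in> W"
  shows "(f has_derivative (\<lambda>q. partial_fst f p * fst q + partial_snd f p * snd q)) (at p)"
proof -
  obtain s w where p: "p = (s, w)" by (cases p)
  have o: "open W" using assms by (simp add: sep_hol_def)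
  obtain r where r: "r > 0" "ball s r \<times> ball w r \<subseteq> W" using open_box[OF o] assms p by metis
  let ?X = "ball s r" and ?Y = "ball w r"
  have "((\<lambda>(x, y). f (x, y)) has_derivative (\<lambda>(tx, ty). partial_fst f (s, w) * tx + blinfun_apply (blinfun_mult_right (partial_snd f (s, w))) ty))
      (at (s, w) within ?X \<times> ?Y)"
  proof (rule has_derivative_partialsI)
    have "((\<lambda>x. f (x, w)) has_field_derivative partial_fst f (s, w)) (at s)"
      using assms p unfolding sep_hol_def partial_fst_def
      by (simp add: DERIV_deriv_iff_field_differentiable)
    then show "((\<lambda>x. f (x, w)) has_derivative (*) (partial_fst f (s, w))) (at s within ?X)"
      unfolding has_field_derivative_def by (rule has_derivative_at_withinI)
    show "((\<lambda>y. f (x, y)) has_derivative blinfun_apply (blinfun_mult_right (partial_snd f (x, y)))) (at y within ?Y)"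
      if "x \<in> ?X" "y \<in> ?Y" for x y
    proof -
      have "(x, y) \<in> W" using that r by auto
      then have "((\<lambda>y. f (x, y)) has_field_derivative partial_snd f (x, y)) (at y)"
        using assms unfolding sep_hol_def partial_snd_def
        by (simp add: DERIV_deriv_iff_field_differentiable)
      then show ?thesis
        unfolding has_field_derivative_def blinfun_mult_right.rep_eq by (rule has_derivative_at_withinI)
    qed
    have "isCont (partial_snd f) p"
      using sep_hol_partial_snd[OF assms(1)] assms(2) unfolding sep_hol_def
      by (metis continuous_on_eq_continuous_at)
    then have "continuous (at p) (\<lambda>q. blinfun_mult_right (partial_snd f q))"
      by (rule bounded_linear.isCont[OF bounded_linear_blinfun_mult_right])
    then show "continuous (at (s, w) within ?X \<times> ?Y) (\<lambda>(x, y). blinfun_mult_right (partial_snd f (x, y)))"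
      using continuous_at_imp_continuous_at_within[of "(s, w)" "\<lambda>q. blinfun_mult_right (partial_snd f q)"] p
      by (simp add: case_prod_beta')
  qed (use r in auto)
  moreover have "at (s, w) within ?X \<times> ?Y = at (s, w)"
    by (rule at_within_open) (use r in \<open>auto intro: open_Times\<close>)
  ultimately show ?thesis using p by (simp add: case_prod_unfold blinfun_mult_right.rep_eq)
qed

section \<open>Curves: chain rule, smoothness and implicit differentiation\<close>

lemma sep_hol_chain:
  fixes u v :: "real \<Rightarrow> complex"
  assumes "sep_hol W f" "(u t, v t) \<in> W"
    and "(u has_vector_derivative u') (at t)" "(v has_vector_derivative v') (at t)"
  shows "((\<lambda>x. f (u x, v x)) has_vector_derivative (partial_fst f (u t, v t) * u' + partial_snd f (u t, v t) * v')) (at t)"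
proof -
  have "((\<lambda>x. (u x, v x)) has_derivative (\<lambda>h. (h *\<^sub>R u', h *\<^sub>R v'))) (at t)"
    using assms(3,4) unfolding has_vector_derivative_def by (rule has_derivative_Pair)
  from has_derivative_compose[OF this sep_hol_has_derivative[OF assms(1,2)]]
  show ?thesis unfolding has_vector_derivative_def by (simp add: algebra_simps scaleR_conv_of_real)
qed


text \<open>The curve solves the autonomous system \<open>x' = h1 (x, y)\<close>,
  \<open>y' = h2 (x, y)\<close>. Differentiating along it maps \<open>f\<close> to
  \<open>D f\<close>, a function of the same class, so induction produces every higher derivative as
  the real part of such a function on the curve.\<close>

lemma smooth_on_sep_hol_curve:
  fixes x y :: "real \<Rightarrow> real"
  assumes I: "open I" and h: "sep_hol W h1" "sep_hol W h2" and f: "sep_hol W f"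
    and W: "\<And>t. t \<in> I \<Longrightarrow> (complex_of_real (x t), complex_of_real (y t)) \<in> W"
    and x: "\<And>t. t \<in> I \<Longrightarrow> \<exists>d. (x has_real_derivative d) (at t) \<and> of_real d = h1 (of_real (x t), of_real (y t))"
    and y: "\<And>t. t \<in> I \<Longrightarrow> \<exists>d. (y has_real_derivative d) (at t) \<and> of_real d = h2 (of_real (x t), of_real (y t))"
  shows "smooth_on I (\<lambda>t. Re (f (of_real (x t), of_real (y t))))"
proof -
  let ?g = "\<lambda>t. (complex_of_real (x t), complex_of_real (y t))"
  define D where "D f p = partial_fst f p * h1 p + partial_snd f p * h2 p" for f p
  have D: "sep_hol W (D f)" if "sep_hol W f" for f
    unfolding D_def[abs_def] using that h by (intro sep_hol_add sep_hol_mult sep_hol_partial_fst sep_hol_partial_snd)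
  have deriv: "((\<lambda>t. Re (f (?g t))) has_real_derivative Re (D f (?g t))) (at t)"
    if f: "sep_hol W f" and t: "t \<in> I" for f t
  proof -
    obtain d1 where d1: "(x has_real_derivative d1) (at t)" "of_real d1 = h1 (?g t)" using x[OF t] by blast
    obtain d2 where d2: "(y has_real_derivative d2) (at t)" "of_real d2 = h2 (?g t)" using y[OF t] by blast
    have "((\<lambda>t. complex_of_real (x t)) has_vector_derivative complex_of_real d1) (at t)"
      "((\<lambda>t. complex_of_real (y t)) has_vector_derivative complex_of_real d2) (at t)"
      using d1(1) d2(1) by (auto intro: has_vector_derivative_of_real simp: has_real_derivative_iff_has_vector_derivative)
    from sep_hol_chain[OF f W[OF t] this]
    have "((\<lambda>t. f (?g t)) has_vector_derivative D f (?g t)) (at t)"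
      by (simp add: D_def d1 d2)
    from bounded_linear.has_vector_derivative[OF bounded_linear_Re this]
    show ?thesis by (simp add: has_real_derivative_iff_has_vector_derivative)
  qed
  have *: "\<exists>g. sep_hol W g \<and> (\<forall>t\<in>I. (deriv ^^ k) (\<lambda>t. Re (f (?g t))) t = Re (g (?g t)))" for k
  proof (induction k)
    case 0
    then show ?case using f by auto
  next
    case (Suc k)
    then obtain g where g: "sep_hol W g" "\<And>t. t \<in> I \<Longrightarrow> (deriv ^^ k) (\<lambda>t. Re (f (?g t))) t = Re (g (?g t))"
      by auto
    have "(deriv ^^ Suc k) (\<lambda>t. Re (f (?g t))) t = Re (D g (?g t))" if t: "t \<in> I" for t
    proof -
      have "((deriv ^^ k) (\<lambda>t. Re (f (?g t))) has_real_derivative Re (D g (?g t))) (at t)"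
        by (rule has_field_derivative_transform_within_open[OF deriv[OF g(1) t] I t]) (simp add: g)
      then show ?thesis by (simp add: DERIV_imp_deriv)
    qed
    then show ?case using D[OF g(1)] by blast
  qed
  show ?thesis
    unfolding smooth_on_def
  proof (intro conjI allI ballI I)
    fix k t assume t: "t \<in> I"
    obtain g where g: "sep_hol W g" "\<And>t. t \<in> I \<Longrightarrow> (deriv ^^ k) (\<lambda>t. Re (f (?g t))) t = Re (g (?g t))"
      using * by blast
    have "((deriv ^^ k) (\<lambda>t. Re (f (?g t))) has_real_derivative Re (D g (?g t))) (at t)"
      by (rule has_field_derivative_transform_within_open[OF deriv[OF g(1) t] I t]) (simp add: g)
    then show "(deriv ^^ k) (\<lambda>t. Re (f (?g t))) field_differentiable at t"
      by (auto simp: field_differentiable_def)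
  qed
qed

text \<open>The solution \<open>u\<close> is given and continuous, so only its derivative is in
  question. Differentiability of \<open>F\<close> makes \<open>A * du + B * dt\<close> small
  compared with \<open>|du| + |dt|\<close>. A first use with a fixed tolerance gives a Lipschitz
  bound, a second one with arbitrary tolerance gives the quotient \<open>- B / A\<close>.\<close>

lemma implicit_function_differentiable:
  fixes u :: "real \<Rightarrow> real" and F :: "complex \<times> complex \<Rightarrow> complex"
  assumes F: "(F has_derivative (\<lambda>q. A * fst q + B * snd q)) (at (of_real (u t0), of_real t0))"
    and A: "A \<noteq> 0" and u: "isCont u t0"
    and zero: "\<forall>\<^sub>F t in nhds t0. F (of_real (u t), of_real t) = 0"
  shows "\<exists>d. (u has_real_derivative d) (at t0)"
proof -
  let ?p = "(complex_of_real (u t0), complex_of_real t0)"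
  have z0: "F ?p = 0" using zero by (rule eventually_nhds_x_imp_x)
  \<comment> \<open>With tolerance \<open>norm A / 2\<close>, half of \<open>norm A * |du|\<close>
    is absorbed on the left; \<open>C\<close> is the quotient that remains.\<close>
  define C where "C = (norm B + norm A / 2) / (norm A / 2)"
  have C: "C > 0" using A by (auto simp: C_def divide_simps intro: add_nonneg_pos)
  have small: "\<forall>\<^sub>F t in at t0. norm (A * of_real (u t - u t0) + B * of_real (t - t0)) \<le> e * (\<bar>u t - u t0\<bar> + \<bar>t - t0\<bar>)"
    if e: "e > 0" for e
  proof -
    obtain d where d: "d > 0" "\<And>q. norm (q - ?p) < d \<Longrightarrow>
        norm (F q - F ?p - (A * fst (q - ?p) + B * snd (q - ?p))) \<le> e * norm (q - ?p)"
      using F e unfolding has_derivative_at_alt by blast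
    have lim: "(\<lambda>t. (complex_of_real (u t), complex_of_real t)) \<midarrow>t0\<rightarrow> ?p"
      using u unfolding isCont_def by (intro tendsto_intros)
    have "\<forall>\<^sub>F t in at t0. dist (complex_of_real (u t), complex_of_real t) ?p < d"
      using tendstoD[OF lim d(1)] .
    moreover have "\<forall>\<^sub>F t in at t0. F (of_real (u t), of_real t) = 0"
      using zero by (simp add: eventually_at_filter eventually_mono)
    ultimately show ?thesis
    proof eventually_elim
      case (elim t)
      let ?q = "(complex_of_real (u t), complex_of_real t)"
      have "norm (F ?q - F ?p - (A * fst (?q - ?p) + B * snd (?q - ?p))) \<le> e * norm (?q - ?p)"
        by (rule d(2)) (use elim in \<open>simp add: dist_norm\<close>)
      also have "norm (?q - ?p) \<le> \<bar>u t - u t0\<bar> + \<bar>t - t0\<bar>"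
        using norm_Pair_le[of "of_real (u t - u t0) :: complex" "of_real (t - t0) :: complex"]
        by (simp only: diff_Pair norm_of_real flip: of_real_diff)
      finally show ?case using e elim z0
        by (simp add: norm_minus_commute flip: norm_minus_cancel[of "A * _ + B * _"])
    qed
  qed
  have "norm A / 2 > 0" using A by simp
  from small[OF this] have lip: "\<forall>\<^sub>F t in at t0. \<bar>u t - u t0\<bar> \<le> C * \<bar>t - t0\<bar>"
  proof eventually_elim
    case (elim t)
    have "norm A * \<bar>u t - u t0\<bar> = norm (A * of_real (u t - u t0))" by (simp add: norm_mult flip: of_real_diff)
    also have "\<dots> \<le> norm (A * of_real (u t - u t0) + B * of_real (t - t0)) + norm (B * of_real (t - t0))"
      by (metis add_diff_cancel_right' norm_triangle_ineq4)
    also have "\<dots> \<le> norm A / 2 * (\<bar>u t - u t0\<bar> + \<bar>t - t0\<bar>) + norm B * \<bar>t - t0\<bar>"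
      using elim by (simp add: norm_mult flip: of_real_diff)
    finally have "norm A / 2 * \<bar>u t - u t0\<bar> \<le> (norm B + norm A / 2) * \<bar>t - t0\<bar>"
      by (simp add: algebra_simps)
    then show ?case using A unfolding C_def by (simp add: field_simps)
  qed
  have "((\<lambda>t. complex_of_real ((u t - u t0) / (t - t0))) \<longlongrightarrow> - B / A) (at t0)"
  proof (rule tendstoI)
    fix e :: real assume e: "e > 0"
    \<comment> \<open>Since \<open>|du| + |dt| \<le> (C + 1) * |dt|\<close>, this tolerance leads to
      the final bound \<open>e / 2\<close>.\<close>
    define e' where "e' = e * norm A / (2 * (C + 1))"
    have e': "e' > 0" using e A C by (simp add: e'_def)
    have "\<forall>\<^sub>F t in at t0. t \<noteq> t0" by (simp add: eventually_at_filter)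
    with small[OF e'] lip show "\<forall>\<^sub>F t in at t0. dist (complex_of_real ((u t - u t0) / (t - t0))) (- B / A) < e"
    proof eventually_elim
      case (elim t)
      have "complex_of_real ((u t - u t0) / (t - t0)) - (- B / A) =
         (A * of_real (u t - u t0) + B * of_real (t - t0)) / (A * of_real (t - t0))"
        using A elim(3) by (simp add: field_simps)
      then have "dist (complex_of_real ((u t - u t0) / (t - t0))) (- B / A) =
          norm (A * of_real (u t - u t0) + B * of_real (t - t0)) / (norm A * \<bar>t - t0\<bar>)"
        unfolding dist_norm by (simp only: norm_divide norm_mult norm_of_real)
      also have "\<dots> \<le> e' * (C * \<bar>t - t0\<bar> + \<bar>t - t0\<bar>) / (norm A * \<bar>t - t0\<bar>)"
      proof (rule divide_right_mono)
        have "e' * (\<bar>u t - u t0\<bar> + \<bar>t - t0\<bar>) \<le> e' * (C * \<bar>t - t0\<bar> + \<bar>t - t0\<bar>)"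
          using elim(2) e' by (intro mult_left_mono) auto
        then show "norm (A * of_real (u t - u t0) + B * of_real (t - t0)) \<le> e' * (C * \<bar>t - t0\<bar> + \<bar>t - t0\<bar>)"
          using elim(1) by linarith
      qed simp
      also have "C * \<bar>t - t0\<bar> + \<bar>t - t0\<bar> = (C + 1) * \<bar>t - t0\<bar>" by (simp add: algebra_simps)
      also have "e' * ((C + 1) * \<bar>t - t0\<bar>) / (norm A * \<bar>t - t0\<bar>) = e / 2"
          using A C elim(3) unfolding e'_def by (simp add: divide_simps)
      also have "\<dots> < e" using e by simp
      finally show ?case .
    qed
  qed
  then have "((\<lambda>t. (u t - u t0) / (t - t0)) \<longlongrightarrow> Re (- B / A)) (at t0)"
    using tendsto_Re by fastforce
  then show ?thesis by (auto simp: has_field_derivative_iff)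
qed


section \<open>Analytic continuation of the Hurwitz zeta function\<close>


lemma sep_hol_uniform_limit:
  assumes f: "\<And>n. sep_hol W (f n)" and lim: "uniform_limit W f g sequentially"
  shows "sep_hol W g"
proof -
  have o: "open W" using f by (auto simp: sep_hol_def)
  have "continuous_on W g"
    by (rule uniform_limit_theorem[OF _ lim]) (use f in \<open>auto simp: sep_hol_def\<close>)
  moreover have "(\<lambda>z. g (z, w)) field_differentiable at s \<and> (\<lambda>z. g (s, z)) field_differentiable at w"
    if sw: "(s, w) \<in> W" for s w
  proof -
    obtain r where r: "r > 0" "ball s r \<times> ball w r \<subseteq> W" using open_box[OF o sw] .
    have *: "\<exists>d>0. cball x d \<subseteq> ball y r \<and> uniform_limit (cball x d) (\<lambda>n z. f n (h z)) (\<lambda>z. g (h z)) sequentially"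
      if x: "x \<in> ball y r" and h: "h ` ball y r \<subseteq> W" for x y :: complex and h
    proof -
      obtain d where d: "d > 0" "cball x d \<subseteq> ball y r"
        using x by (metis open_ball open_contains_cball)
      moreover have "uniform_limit (h ` cball x d) f g sequentially"
        by (rule uniform_limit_on_subset[OF lim]) (use d h in blast)
      then have "uniform_limit (cball x d) (\<lambda>n z. f n (h z)) (\<lambda>z. g (h z)) sequentially"
        by (auto simp: uniform_limit_iff)
      ultimately show ?thesis by blast
    qed
    have "(\<lambda>z. g (z, w)) holomorphic_on ball s r"
    proof (rule holomorphic_uniform_sequence[where f = "\<lambda>n z. f n (z, w)"])
      show "(\<lambda>z. f n (z, w)) holomorphic_on ball s r" for n
        by (rule sep_hol_box(1)[OF f r(2)]) (use r in auto)
      show "\<exists>d. 0 < d \<and> cball x d \<subseteq> ball s r \<and> uniform_limit (cball x d) (\<lambda>n z. f n (z, w)) (\<lambda>z. g (z, w)) sequentially"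
        if "x \<in> ball s r" for x
        by (rule *[OF that]) (use r in auto)
    qed auto
    moreover have "(\<lambda>z. g (s, z)) holomorphic_on ball w r"
    proof (rule holomorphic_uniform_sequence[where f = "\<lambda>n z. f n (s, z)"])
      show "(\<lambda>z. f n (s, z)) holomorphic_on ball w r" for n
        by (rule sep_hol_box(2)[OF f r(2)]) (use r in auto)
      show "\<exists>d. 0 < d \<and> cball x d \<subseteq> ball w r \<and> uniform_limit (cball x d) (\<lambda>n z. f n (s, z)) (\<lambda>z. g (s, z)) sequentially"
        if "x \<in> ball w r" for x
        by (rule *[OF that]) (use r in auto)
    qed auto
    ultimately show ?thesis using r by (auto intro!: holomorphic_on_imp_differentiable_at)
  qed
  ultimately show ?thesis using o by (auto simp: sep_hol_def)
qed

lemma sep_hol_shift: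
  assumes f: "sep_hol W f" and o: "open V" and V: "\<And>s w. (s, w) \<in> V \<Longrightarrow> (s + a, w + b) \<in> W"
  shows "sep_hol V (\<lambda>p. f (fst p + a, snd p + b))"
  unfolding sep_hol_def
proof (intro conjI allI impI o)
  have "continuous_on W f" using f by (simp add: sep_hol_def)
  then show "continuous_on V (\<lambda>p. f (fst p + a, snd p + b))"
    by (rule continuous_on_compose2) (use V in \<open>auto intro!: continuous_intros\<close>)
  fix s w assume sw: "(s, w) \<in> V"
  have d: "(\<lambda>z. f (z, w + b)) field_differentiable at (s + a)" "(\<lambda>z. f (s + a, z)) field_differentiable at (w + b)"
    using f V[OF sw] by (auto simp: sep_hol_def)
  have "((\<lambda>z. f (z, w + b)) \<circ> (\<lambda>z. z + a)) field_differentiable at s"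
    by (rule field_differentiable_compose) (use d in \<open>auto intro!: field_differentiable_add\<close>)
  then show "(\<lambda>z. f (fst (z, w) + a, snd (z, w) + b)) field_differentiable at s"
    by (simp add: o_def)
  have "((\<lambda>z. f (s + a, z)) \<circ> (\<lambda>z. z + b)) field_differentiable at w"
    by (rule field_differentiable_compose) (use d in \<open>auto intro!: field_differentiable_add\<close>)
  then show "(\<lambda>z. f (fst (s, z) + a, snd (s, z) + b)) field_differentiable at w"
    by (simp add: o_def)
qed

lemma sep_hol_integral:
  fixes f :: "(complex \<times> complex) \<times> real \<Rightarrow> complex"
  assumes o: "open W" and cont: "continuous_on (W \<times> {a..b}) f"
    and f: "\<And>t. t \<in> {a..b} \<Longrightarrow> sep_hol W (\<lambda>p. f (p, t))"
  shows "sep_hol W (\<lambda>p. integral {a..b} (\<lambda>t. f (p, t)))"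
  unfolding sep_hol_def
proof (intro conjI allI impI o)
  show "continuous_on W (\<lambda>p. integral {a..b} (\<lambda>t. f (p, t)))"
    using integral_continuous_on_param[of W a b "\<lambda>p t. f (p, t)"] cont by (simp add: case_prod_unfold)
  fix s w assume sw: "(s, w) \<in> W"
  obtain r where r: "r > 0" "ball s r \<times> ball w r \<subseteq> W" using open_box[OF o sw] .
  have "(\<lambda>z. integral {a..b} (\<lambda>t. (\<lambda>(z, t). f ((z, w), t)) (z, t))) holomorphic_on ball s r"
  proof (rule holomorphic_on_integral_param)
    show "continuous_on (ball s r \<times> {a..b}) (\<lambda>(z, t). f ((z, w), t))"
      unfolding case_prod_unfold
      by (rule continuous_on_compose2[OF cont]) (use r in \<open>auto intro!: continuous_intros\<close>)
    show "(\<lambda>z. (\<lambda>(z, t). f ((z, w), t)) (z, t)) holomorphic_on ball s r" if "t \<in> {a..b}" for t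
      unfolding split by (rule sep_hol_box(1)[OF f[OF that] r(2)]) (use r in auto)
  qed simp
  then show "(\<lambda>z. integral {a..b} (\<lambda>t. f ((z, w), t))) field_differentiable at s"
    using r by (auto intro!: holomorphic_on_imp_differentiable_at)
  have "(\<lambda>z. integral {a..b} (\<lambda>t. (\<lambda>(z, t). f ((s, z), t)) (z, t))) holomorphic_on ball w r"
  proof (rule holomorphic_on_integral_param)
    show "continuous_on (ball w r \<times> {a..b}) (\<lambda>(z, t). f ((s, z), t))"
      unfolding case_prod_unfold
      by (rule continuous_on_compose2[OF cont]) (use r in \<open>auto intro!: continuous_intros\<close>)
    show "(\<lambda>z. (\<lambda>(z, t). f ((s, z), t)) (z, t)) holomorphic_on ball w r" if "t \<in> {a..b}" for t
      unfolding split by (rule sep_hol_box(2)[OF f[OF that] r(2)]) (use r in auto)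
  qed simp
  then show "(\<lambda>z. integral {a..b} (\<lambda>t. f ((s, z), t))) field_differentiable at w"
    using r by (auto intro!: holomorphic_on_imp_differentiable_at)
qed

section \<open>The Dirichlet series for Re s > 1\<close>

lemma Re_pos_notin_nonpos: "Re z > 0 \<Longrightarrow> z \<notin> \<real>\<^sub>\<le>\<^sub>0"
  by (auto elim!: nonpos_Reals_cases)

lemma open_right_half: "open {w. Re w > c}"
  by (intro open_Collect_less continuous_intros)

lemma sep_hol_powr:
  "sep_hol (UNIV \<times> {w. Re w > 0}) (\<lambda>p. (of_nat n + snd p) powr (c - fst p))"
  unfolding sep_hol_def
proof (intro conjI allI impI)
  let ?W = "UNIV \<times> {w. Re w > 0} :: (complex \<times> complex) set"
  show "open ?W" by (intro open_Times open_right_half) auto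
  have *: "of_nat n + w \<notin> \<real>\<^sub>\<le>\<^sub>0" "of_nat n + w \<noteq> 0" if "Re w > 0" for w
  proof -
    show "of_nat n + w \<notin> \<real>\<^sub>\<le>\<^sub>0" using that by (intro Re_pos_notin_nonpos) auto
    then show "of_nat n + w \<noteq> 0" by auto
  qed
  have "continuous_on ?W (\<lambda>p. exp ((c - fst p) * Ln (of_nat n + snd p)))"
    using * by (intro continuous_intros) auto
  then show "continuous_on ?W (\<lambda>p. (of_nat n + snd p) powr (c - fst p))"
    by (rule continuous_on_eq) (use * in \<open>auto simp: powr_def\<close>)
  fix s w assume "(s, w) \<in> ?W"
  then have w: "Re w > 0" by simp
  have "(\<lambda>z. (of_nat n + w) powr (c - z)) holomorphic_on UNIV"
    using *[OF w] by (intro holomorphic_intros) auto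
  then show "(\<lambda>z. (of_nat n + snd (z, w)) powr (c - fst (z, w))) field_differentiable at s"
    by (simp add: holomorphic_on_imp_differentiable_at)
  have "(\<lambda>z. (of_nat n + z) powr (c - s)) holomorphic_on {w. Re w > 0}"
    using * by (intro holomorphic_intros) auto
  then show "(\<lambda>z. (of_nat n + snd (s, z)) powr (c - fst (s, z))) field_differentiable at w"
    using w open_right_half[of 0] by (auto intro: holomorphic_on_imp_differentiable_at)
qed

text \<open>For \<open>z = n + w\<close> the norm is
  \<open>norm z powr (- Re s) * exp (Im s * Im (Ln z))\<close>; the factor
  \<open>exp (pi * M)\<close> pays for the argument of \<open>z\<close>. The index 0 is excluded
  because \<open>w\<close> may come arbitrarily close to 0.\<close>

lemma norm_powr_le:
  assumes w: "Re w > 0" and n: "n \<ge> 1" and s: "Re s \<ge> x" "x \<ge> 0" "\<bar>Im s\<bar> \<le> M"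
  shows "norm ((of_nat n + w) powr (-s)) \<le> exp (pi * M) * real n powr (-x)"
proof -
  let ?z = "of_nat n + w"
  have "real n \<le> Re ?z" using w by simp
  also have "\<dots> \<le> norm ?z" by (rule complex_Re_le_cmod)
  finally have nz: "real n \<le> norm ?z" .
  have z: "?z \<noteq> 0" using nz n by auto
  have "ln (real n) \<le> ln (norm ?z)" using nz n by (intro ln_mono) auto
  moreover have "0 \<le> ln (real n)" using n by simp
  ultimately have "x * ln (real n) \<le> Re s * ln (norm ?z)" using s by (intro mult_mono) auto
  moreover have "Im s * Im (Ln ?z) \<le> \<bar>Im s\<bar> * \<bar>Im (Ln ?z)\<bar>" by (metis abs_ge_self abs_mult)
  moreover have "\<bar>Im s\<bar> * \<bar>Im (Ln ?z)\<bar> \<le> M * pi"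
    using s mpi_less_Im_Ln[OF z] Im_Ln_le_pi[OF z] by (intro mult_mono) auto
  ultimately have "Re (-s * Ln ?z) \<le> pi * M + (-x) * ln (real n)" using z by (simp add: algebra_simps)
  then have "exp (Re (-s * Ln ?z)) \<le> exp (pi * M + (-x) * ln (real n))" by simp
  then show ?thesis using z n by (simp only: powr_def norm_exp_eq_Re exp_add) auto
qed

definition hurwitz_series :: "complex \<Rightarrow> complex \<Rightarrow> complex" where
  "hurwitz_series s w = (\<Sum>n. (of_nat n + w) powr (-s))"

text \<open>The majorant does not depend on \<open>w\<close>; bounding \<open>Im s\<close> makes
  this possible. It is valid from index 1 on, hence the eventual form of the M-test.\<close>

lemma hurwitz_series_uniform:
  assumes "x > 1"
  shows "uniform_limit ({s. Re s \<ge> x \<and> \<bar>Im s\<bar> \<le> M} \<times> {w. Re w > 0})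
     (\<lambda>n p. \<Sum>i<n. (of_nat i + snd p) powr (- fst p)) (\<lambda>p. hurwitz_series (fst p) (snd p)) sequentially"
  unfolding hurwitz_series_def
proof (rule Weierstrass_m_test_ev)
  show "\<forall>\<^sub>F n in sequentially. \<forall>p\<in>{s. Re s \<ge> x \<and> \<bar>Im s\<bar> \<le> M} \<times> {w. Re w > 0}.
      norm ((of_nat n + snd p) powr (- fst p)) \<le> exp (pi * M) * real n powr (-x)"
    using eventually_ge_at_top[of 1]
    by eventually_elim (use assms in \<open>auto intro!: norm_powr_le\<close>)
  show "summable (\<lambda>n. exp (pi * M) * real n powr (-x))"
    using assms by (intro summable_mult) (simp add: summable_real_powr_iff)
qed

lemma hurwitz_series_sums:
  assumes "Re s > 1" "Re w > 0"
  shows "(\<lambda>n. (of_nat n + w) powr (-s)) sums hurwitz_series s w"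
  unfolding sums_def
  using tendsto_uniform_limitI[OF hurwitz_series_uniform[of "Re s" "\<bar>Im s\<bar>"], of "(s, w)"] assms by simp

lemma sep_hol_hurwitz_series:
  "sep_hol ({s. Re s > 1} \<times> {w. Re w > 0}) (\<lambda>p. hurwitz_series (fst p) (snd p))"
proof (rule sep_hol_local)
  fix p :: "complex \<times> complex" assume "p \<in> {s. Re s > 1} \<times> {w. Re w > 0}"
  then obtain s w where p: "p = (s, w)" "Re s > 1" "Re w > 0" by auto
  define x where "x = (1 + Re s) / 2"
  have x: "x > 1" "Re s > x" using p by (auto simp: x_def field_simps)
  define W where "W = ({z. Re z > x} \<inter> {z. \<bar>Im z\<bar> < \<bar>Im s\<bar> + 1}) \<times> {w. Re w > 0}"
  have oW: "open W" unfolding W_def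
    by (intro open_Times open_Int open_right_half open_Collect_less continuous_intros)
  have "sep_hol W (\<lambda>p. hurwitz_series (fst p) (snd p))"
  proof (rule sep_hol_uniform_limit)
    show "uniform_limit W (\<lambda>n p. \<Sum>i<n. (of_nat i + snd p) powr (- fst p)) (\<lambda>p. hurwitz_series (fst p) (snd p)) sequentially"
      by (rule uniform_limit_on_subset[OF hurwitz_series_uniform[OF x(1), of "\<bar>Im s\<bar> + 1"]]) (auto simp: W_def)
    have t: "sep_hol W (\<lambda>p. (of_nat i + snd p) powr (- fst p))" for i
      using sep_hol_subset[OF sep_hol_powr[of i 0] _ oW] by (auto simp: W_def)
    show "sep_hol W (\<lambda>p. \<Sum>i<n. (of_nat i + snd p) powr (- fst p))" for n
      by (induction n) (auto intro: sep_hol_const oW sep_hol_add t)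
  qed
  then show "\<exists>W'. p \<in> W' \<and> W' \<subseteq> {s. Re s > 1} \<times> {w. Re w > 0} \<and> sep_hol W' (\<lambda>p. hurwitz_series (fst p) (snd p))"
    using p x by (intro exI[of _ W]) (auto simp: W_def)
qed

text \<open>
  Taylor's formula gives \<open>\<zeta>(s, w) = w powr (1 - s) / (s - 1) + s * \<integral> (1 - v) \<zeta>(s + 1, w + v) dv\<close> over
  \<open>0 \<le> v \<le> 1\<close>. Multiplied by \<open>s - 1\<close>, it involves no pole and extends the domain by one unit
  to the left at each step.
\<close>

primrec hurwitz_step :: "nat \<Rightarrow> complex \<times> complex \<Rightarrow> complex" where
  "hurwitz_step 0 p = (fst p - 1) * hurwitz_series (fst p) (snd p)"
| "hurwitz_step (Suc m) p = snd p powr (1 - fst p) +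
     (fst p - 1) * integral {0..1} (\<lambda>v. (1 - of_real v) * hurwitz_step m (fst p + 1, snd p + of_real v))"

definition hurwitz_domain :: "nat \<Rightarrow> (complex \<times> complex) set" where
  "hurwitz_domain m = {s. Re s > 1 - real m} \<times> {w. Re w > 0}"

lemma open_hurwitz_domain: "open (hurwitz_domain m)"
  unfolding hurwitz_domain_def by (intro open_Times open_right_half)

lemma sep_hol_hurwitz_step: "sep_hol (hurwitz_domain m) (hurwitz_step m)"
proof (induction m)
  case 0
  have "sep_hol (hurwitz_domain 0) (\<lambda>p. (fst p + - 1) * hurwitz_series (fst p) (snd p))"
    using sep_hol_hurwitz_series open_hurwitz_domain[of 0]
    by (intro sep_hol_mult sep_hol_add sep_hol_fst sep_hol_const) (auto simp: hurwitz_domain_def)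
  then show ?case by (rule sep_hol_cong) auto
next
  case (Suc m)
  have sh: "(s + 1, w + of_real v) \<in> hurwitz_domain m" if "(s, w) \<in> hurwitz_domain (Suc m)" "v \<in> {0..1}" for s w v
    using that by (auto simp: hurwitz_domain_def)
  have "sep_hol (hurwitz_domain (Suc m)) (\<lambda>p. integral {0..1} (\<lambda>v. (\<lambda>(p, v). (1 - of_real v) * hurwitz_step m (fst p + 1, snd p + of_real v)) (p, v)))"
  proof (rule sep_hol_integral[OF open_hurwitz_domain])
    have c: "continuous_on (hurwitz_domain m) (hurwitz_step m)" using Suc by (simp add: sep_hol_def)
    show "continuous_on (hurwitz_domain (Suc m) \<times> {0..1}) (\<lambda>(p, v). (1 - complex_of_real v) * hurwitz_step m (fst p + 1, snd p + of_real v))"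
      unfolding case_prod_unfold
    proof (intro continuous_intros)
      show "continuous_on (hurwitz_domain (Suc m) \<times> {0..1}) (\<lambda>q. hurwitz_step m (fst (fst q) + 1, snd (fst q) + complex_of_real (snd q)))"
        by (rule continuous_on_compose2[OF c]) (use sh in \<open>auto intro!: continuous_intros\<close>)
    qed
    show "sep_hol (hurwitz_domain (Suc m)) (\<lambda>p. (\<lambda>(p, v). (1 - of_real v) * hurwitz_step m (fst p + 1, snd p + of_real v)) (p, v))"
      if "v \<in> {0..1}" for v
      unfolding split by (intro sep_hol_mult sep_hol_const open_hurwitz_domain sep_hol_shift[OF Suc]) (use sh that in auto)
  qed
  then have i: "sep_hol (hurwitz_domain (Suc m)) (\<lambda>p. integral {0..1} (\<lambda>v. (1 - of_real v) * hurwitz_step m (fst p + 1, snd p + of_real v)))"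
    by simp
  have "sep_hol (hurwitz_domain (Suc m)) (\<lambda>p. snd p powr (1 - fst p))"
    using sep_hol_subset[OF sep_hol_powr[of 0 1] _ open_hurwitz_domain[of "Suc m"]] by (auto simp: hurwitz_domain_def)
  then have "sep_hol (hurwitz_domain (Suc m)) (\<lambda>p. snd p powr (1 - fst p) + (fst p + - 1) *
       integral {0..1} (\<lambda>v. (1 - of_real v) * hurwitz_step m (fst p + 1, snd p + of_real v)))"
    by (intro sep_hol_add sep_hol_mult sep_hol_fst sep_hol_const i open_hurwitz_domain)
  then show ?case by (rule sep_hol_cong) auto
qed

text \<open>Taylor's formula with integral remainder for
  \<open>v \<mapsto> (b + v) powr (1 - s)\<close> between 0 and 1; \<open>G\<close> is the
  antiderivative found by integrating by parts once.\<close>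

lemma has_integral_taylor_powr:
  fixes b s :: complex
  assumes b: "Re b > 0"
  shows "((\<lambda>v. (s - 1) * s * (1 - of_real v) * (b + of_real v) powr (-s - 1)) has_integral
     ((s - 1) * b powr (-s) + (b + 1) powr (1 - s) - b powr (1 - s))) {0..1}"
proof -
  define G where "G z = (b + z) powr (1 - s) - (s - 1) * (1 - z) * (b + z) powr (-s)" for z
  have d: "((\<lambda>z. (b + z) powr r) has_field_derivative r * (b + z) powr (r - 1)) (at z)" if "Re (b + z) > 0" for r z
    using Re_pos_notin_nonpos[OF that] by (auto intro!: derivative_eq_intros)
  have "((\<lambda>v. (s - 1) * s * (1 - of_real v) * (b + of_real v) powr (-s - 1)) has_integral
     (G (of_real 1) - G (of_real 0))) {0..1}"
  proof (rule fundamental_theorem_of_calculus)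
    fix v :: real assume v: "v \<in> {0..1}"
    have "Re (b + of_real v) > 0" using b v by simp
    note d = d[OF this]
    have "(G has_field_derivative ((1 - s) * (b + of_real v) powr (1 - s - 1) -
       ((s - 1) * (0 - 1) * (b + of_real v) powr (-s) + (-s * (b + of_real v) powr (-s - 1)) * ((s - 1) * (1 - of_real v))))) (at (of_real v))"
      unfolding G_def[abs_def]
      by (intro DERIV_diff DERIV_mult d DERIV_cmult DERIV_const DERIV_ident)
    also have "((1 - s) * (b + of_real v) powr (1 - s - 1) -
       ((s - 1) * (0 - 1) * (b + of_real v) powr (-s) + (-s * (b + of_real v) powr (-s - 1)) * ((s - 1) * (1 - of_real v))))
       = (s - 1) * s * (1 - of_real v) * (b + of_real v) powr (-s - 1)"
      by (simp add: algebra_simps)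
    finally show "((\<lambda>x. G (of_real x)) has_vector_derivative (s - 1) * s * (1 - of_real v) * (b + of_real v) powr (-s - 1)) (at v within {0..1})"
      by (rule has_vector_derivative_real_field)
  qed simp
  then show ?thesis by (simp add: G_def algebra_simps)
qed

text \<open>Adding the Taylor remainders for \<open>b = n + w\<close> only involves the series at
  exponent \<open>s + 1\<close>, which converges uniformly in \<open>v\<close> as soon as
  \<open>Re s > 0\<close>. The resulting series thus reaches one unit beyond the Dirichlet
  series.\<close>

lemma hurwitz_step_1_sums:
  assumes s: "Re s > 0" and w: "Re w > 0"
  shows "(\<lambda>n. (s - 1) * (of_nat n + w) powr (-s) + (of_nat (Suc n) + w) powr (1 - s) - (of_nat n + w) powr (1 - s))
     sums (hurwitz_step 1 (s, w) - w powr (1 - s))"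
proof -
  define h where "h n v = (s - 1) * s * (1 - complex_of_real v) * ((of_nat n + w) + of_real v) powr (-s - 1)" for n :: nat and v
  have "uniform_limit {0..1} (\<lambda>n v. \<Sum>i<n. (of_nat i + (w + complex_of_real v)) powr (- (s + 1)))
      (\<lambda>v. hurwitz_series (s + 1) (w + of_real v)) sequentially"
    using uniform_limit_compose'[OF hurwitz_series_uniform[of "Re (s + 1)" "\<bar>Im s\<bar>"], of "\<lambda>v. (s + 1, w + complex_of_real v)" "{0..1}"] s w
    by simp
  then have "uniform_limit {0..1} (\<lambda>n v. ((s - 1) * s * (1 - complex_of_real v)) * (\<Sum>i<n. (of_nat i + (w + complex_of_real v)) powr (- (s + 1))))
      (\<lambda>v. ((s - 1) * s * (1 - complex_of_real v)) * hurwitz_series (s + 1) (w + of_real v)) sequentially"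
  proof (rule uniform_lim_mult[OF uniform_limit_const])
    show "bounded ((\<lambda>v. (s - 1) * s * (1 - complex_of_real v)) ` {0..1})"
      by (intro compact_imp_bounded compact_continuous_image continuous_intros) auto
    have c: "continuous_on ({s. Re s > 1} \<times> {w. Re w > 0}) (\<lambda>p. hurwitz_series (fst p) (snd p))"
      using sep_hol_hurwitz_series by (simp add: sep_hol_def)
    have "continuous_on {0..1} (\<lambda>v. hurwitz_series (fst (s + 1, w + complex_of_real v)) (snd (s + 1, w + complex_of_real v)))"
      by (rule continuous_on_compose2[OF c]) (use s w in \<open>auto intro!: continuous_intros\<close>)
    then show "bounded ((\<lambda>v. hurwitz_series (s + 1) (w + complex_of_real v)) ` {0..1})"
      by (intro compact_imp_bounded compact_continuous_image) auto
  qed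
  also have "(\<lambda>n v. ((s - 1) * s * (1 - complex_of_real v)) * (\<Sum>i<n. (of_nat i + (w + complex_of_real v)) powr (- (s + 1))))
      = (\<lambda>n v. \<Sum>i<n. h i v)"
    by (simp add: h_def sum_distrib_left add.assoc fun_eq_iff)
  finally have lim: "uniform_limit {0..1} (\<lambda>n v. \<Sum>i<n. h i v)
      (\<lambda>v. ((s - 1) * s * (1 - complex_of_real v)) * hurwitz_series (s + 1) (w + of_real v)) sequentially" .
  have hi: "(h n has_integral ((s - 1) * (of_nat n + w) powr (-s) + (of_nat (Suc n) + w) powr (1 - s) - (of_nat n + w) powr (1 - s))) {0..1}" for n
    unfolding h_def[abs_def] using has_integral_taylor_powr[of "of_nat n + w" s] w by (simp add: add_ac)
  have hc: "continuous_on {0..1} (h n)" for n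
  proof -
    have *: "of_nat n + w + of_real v \<notin> \<real>\<^sub>\<le>\<^sub>0" if "v \<in> {0..1}" for v
      using that w by (intro Re_pos_notin_nonpos) auto
    have "continuous_on {0..1} (\<lambda>v. (s - 1) * s * (1 - complex_of_real v) * exp ((-s - 1) * Ln (of_nat n + w + of_real v)))"
      by (intro continuous_intros *)
    then show ?thesis
      by (rule continuous_on_eq) (use * in \<open>force simp: h_def powr_def\<close>)
  qed
  obtain I J where I: "\<And>n. ((\<lambda>v. \<Sum>i<n. h i v) has_integral I n) {0..1}"
    and J: "((\<lambda>v. ((s - 1) * s * (1 - complex_of_real v)) * hurwitz_series (s + 1) (w + of_real v)) has_integral J) {0..1}"
    and IJ: "I \<longlonglongrightarrow> J"
    using uniform_limit_integral[OF lim] hc by (auto intro!: continuous_intros)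
  have In: "I n = (\<Sum>i<n. (s - 1) * (of_nat i + w) powr (-s) + (of_nat (Suc i) + w) powr (1 - s) - (of_nat i + w) powr (1 - s))" for n
    using I[of n] by (rule has_integral_unique) (intro has_integral_sum hi, auto)
  have Jn: "J = hurwitz_step 1 (s, w) - w powr (1 - s)"
  proof -
    \<comment> \<open>At the argument \<open>s + 1\<close> the factor \<open>fst p - 1\<close> of
      \<open>hurwitz_step 0\<close> equals \<open>s\<close>.\<close>
    have "hurwitz_step 1 (s, w) - w powr (1 - s) = (s - 1) * integral {0..1} (\<lambda>v. (1 - complex_of_real v) * (s * hurwitz_series (s + 1) (w + of_real v)))"
      by simp
    also have "\<dots> = integral {0..1} (\<lambda>v. (s - 1) * ((1 - complex_of_real v) * (s * hurwitz_series (s + 1) (w + of_real v))))"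
      by simp
    also have "\<dots> = J"
      using J by (intro integral_unique) (simp add: mult_ac)
    finally show ?thesis by simp
  qed
  show ?thesis using IJ unfolding sums_def Jn[symmetric] In[symmetric] .
qed

text \<open>For \<open>Re s > 1\<close> the powers \<open>(n + w) powr (1 - s)\<close> tend to 0, so
  the series of Taylor remainders splits into a multiple of the Dirichlet series and a part that
  telescopes to \<open>- w powr (1 - s)\<close>.\<close>

lemma hurwitz_step_1_eq_0:
  assumes s: "Re s > 1" and w: "Re w > 0"
  shows "hurwitz_step 1 (s, w) = hurwitz_step 0 (s, w)"
proof -
  define b where "b n = (of_nat n + w) powr (1 - s)" for n :: nat
  have "(\<lambda>n. exp (pi * \<bar>Im (s - 1)\<bar>) * real n powr (- (Re s - 1))) \<longlonglongrightarrow> exp (pi * \<bar>Im (s - 1)\<bar>) * 0"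
    using s by (intro tendsto_intros tendsto_neg_powr filterlim_real_sequentially) auto
  then have lim: "(\<lambda>n. exp (pi * \<bar>Im (s - 1)\<bar>) * real n powr (- (Re s - 1))) \<longlonglongrightarrow> 0" by simp
  have bnd: "\<forall>\<^sub>F n in sequentially. norm (b n) \<le> exp (pi * \<bar>Im (s - 1)\<bar>) * real n powr (- (Re s - 1))"
    using eventually_ge_at_top[of 1]
  proof eventually_elim
    case (elim n)
    then show ?case
      using norm_powr_le[OF w elim, of "Re s - 1" "s - 1" "\<bar>Im (s - 1)\<bar>"] s
      by (simp add: b_def)
  qed
  have "b \<longlonglongrightarrow> 0" by (rule Lim_null_comparison[OF bnd lim])
  from sums_add[OF sums_mult[OF hurwitz_series_sums[OF s w], of "s - 1"] telescope_sums[OF this]]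
  have "(\<lambda>n. (s - 1) * (of_nat n + w) powr (-s) + (of_nat (Suc n) + w) powr (1 - s) - (of_nat n + w) powr (1 - s))
     sums (hurwitz_step 0 (s, w) - w powr (1 - s))" by (simp add: b_def algebra_simps)
  moreover have "Re s > 0" using s by simp
  ultimately have "hurwitz_step 1 (s, w) - w powr (1 - s) = hurwitz_step 0 (s, w) - w powr (1 - s)"
    using sums_unique2[OF hurwitz_step_1_sums[OF _ w]] by blast
  then show ?thesis by (simp only: diff_conv_add_uminus add_right_cancel)
qed

lemma hurwitz_step_Suc_eq: "(s, w) \<in> hurwitz_domain m \<Longrightarrow> hurwitz_step (Suc m) (s, w) = hurwitz_step m (s, w)"
proof (induction m arbitrary: s w)
  case 0
  then show ?case using hurwitz_step_1_eq_0[of s w] by (simp add: hurwitz_domain_def)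
next
  case (Suc m)
  have "hurwitz_step (Suc m) (s + 1, w + of_real v) = hurwitz_step m (s + 1, w + of_real v)" if "v \<in> {0..1}" for v
    by (rule Suc.IH) (use Suc.prems that in \<open>auto simp: hurwitz_domain_def\<close>)
  then have "integral {0..1} (\<lambda>v. (1 - of_real v) * hurwitz_step (Suc m) (s + 1, w + of_real v)) =
      integral {0..1} (\<lambda>v. (1 - of_real v) * hurwitz_step m (s + 1, w + of_real v))"
    by (intro integral_cong) auto
  then show ?case by (simp only: hurwitz_step.simps(2)[of "Suc m"] hurwitz_step.simps(2)[of m "(s, w)"] fst_conv snd_conv)
qed

lemma hurwitz_step_eq: "m \<le> n \<Longrightarrow> p \<in> hurwitz_domain m \<Longrightarrow> hurwitz_step n p = hurwitz_step m p"
proof (induction n rule: dec_induct)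
  case (step n)
  then have "p \<in> hurwitz_domain n" by (auto simp: hurwitz_domain_def)
  then show ?case using step hurwitz_step_Suc_eq[of "fst p" "snd p" n] by simp
qed auto

text \<open>This is \<open>(s - 1) \<zeta>(s, w)\<close>, which has no pole at \<open>s = 1\<close>.\<close>

definition hurwitz_reg :: "complex \<times> complex \<Rightarrow> complex" where
  "hurwitz_reg p = hurwitz_step (nat \<lceil>1 - Re (fst p)\<rceil> + 1) p"

lemma hurwitz_reg_eq: "p \<in> hurwitz_domain m \<Longrightarrow> hurwitz_reg p = hurwitz_step m p"
proof -
  assume p: "p \<in> hurwitz_domain m"
  \<comment> \<open>The ceiling is at least \<open>1 - Re (fst p)\<close>; the extra 1 gives the
    strict inequality in \<open>hurwitz_domain\<close>.\<close>
  let ?k = "nat \<lceil>1 - Re (fst p)\<rceil> + 1"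
  have "p \<in> hurwitz_domain ?k" using p by (auto simp: hurwitz_domain_def) linarith
  then show ?thesis unfolding hurwitz_reg_def using p hurwitz_step_eq[of m ?k p] hurwitz_step_eq[of ?k m p] by (cases "m \<le> ?k") auto
qed

lemma sep_hol_hurwitz_reg: "sep_hol (UNIV \<times> {w. Re w > 0}) hurwitz_reg"
proof (rule sep_hol_local)
  fix p :: "complex \<times> complex" assume p: "p \<in> UNIV \<times> {w. Re w > 0}"
  let ?k = "nat \<lceil>1 - Re (fst p)\<rceil> + 1"
  have "p \<in> hurwitz_domain ?k" using p by (auto simp: hurwitz_domain_def) linarith
  moreover have "sep_hol (hurwitz_domain ?k) hurwitz_reg" by (rule sep_hol_cong[OF sep_hol_hurwitz_step]) (simp add: hurwitz_reg_eq)
  moreover have "hurwitz_domain ?k \<subseteq> UNIV \<times> {w. Re w > 0}" by (auto simp: hurwitz_domain_def)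
  ultimately show "\<exists>W'. p \<in> W' \<and> W' \<subseteq> UNIV \<times> {w. Re w > 0} \<and> sep_hol W' hurwitz_reg" by blast
qed

lemma hurwitz_reg_1: "Re w > 0 \<Longrightarrow> hurwitz_reg (1, w) = 1"
  using hurwitz_reg_eq[of "(1, w)" 1] by (auto simp: hurwitz_domain_def)

text \<open>This is the classical value \<open>1/2 - w\<close> of zeta at 0, which supplies the sign
  at the left end of the interval. Two steps reach \<open>s = 0\<close>; the inner one is evaluated
  at \<open>s = 1\<close>, where it is constantly 1.\<close>

lemma hurwitz_reg_0: assumes w: "Re w > 0" shows "hurwitz_reg (0, w) = w - 1 / 2"
proof -
  have "hurwitz_step 1 (1, w + of_real v) = 1" if "v \<in> {0..1}" for v
  proof -
    \<comment> \<open>The base has to be nonzero: \<open>0 powr 0\<close> is 0, whereas the value 1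
      is wanted.\<close>
    have "Re (w + of_real v) > 0" using w that by simp
    then have "w + of_real v \<noteq> 0" by (metis less_irrefl zero_complex.simps(1))
    then show ?thesis by simp
  qed
  then have "integral {0..1} (\<lambda>v. (1 - complex_of_real v) * hurwitz_step 1 (1, w + of_real v)) = integral {0..1} (\<lambda>v. of_real (1 - v))"
    by (intro integral_cong) auto
  also have "((\<lambda>v. 1 - v) has_integral ((1 - 1^2/2) - (0 - 0^2/2))) {0..1::real}"
    by (rule fundamental_theorem_of_calculus)
      (auto intro!: derivative_eq_intros simp flip: has_real_derivative_iff_has_vector_derivative)
  then have "integral {0..1} (\<lambda>v. complex_of_real (1 - v)) = of_real (1 / 2)"
    by (intro integral_unique has_integral_of_real) simp
  finally have "hurwitz_step (Suc 1) (0, w) = w - 1 / 2" using w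
    unfolding hurwitz_step.simps(2)[of 1] by (simp only: fst_conv snd_conv add_0 diff_0_right) (simp add: powr_to_1)
  moreover have "hurwitz_reg (0, w) = hurwitz_step (Suc 1) (0, w)" by (rule hurwitz_reg_eq) (use w in \<open>auto simp: hurwitz_domain_def\<close>)
  ultimately show ?thesis by simp
qed

text \<open>The punctured plane is connected, so two continuations agree on it, and the prescribed
  value at 1 settles the remaining point; the definite description therefore selects the constructed
  function.\<close>

lemma hurwitz_zeta_eq:
  assumes a: "a > 0"
  shows "hurwitz_zeta a s = (if s = 1 then 0 else hurwitz_reg (s, of_real a) / (s - 1))"
proof -
  define f where "f s = (if s = 1 then 0 else hurwitz_reg (s, of_real a) / (s - 1))" for s
  have holf: "f holomorphic_on - {1}"
  proof -
    have "(\<lambda>s. hurwitz_reg (s, of_real a)) holomorphic_on UNIV"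
      by (rule sep_hol_box(1)[OF sep_hol_hurwitz_reg, where V = "{w. Re w > 0}"]) (use a open_right_half in auto)
    then have "(\<lambda>s. hurwitz_reg (s, of_real a) / (s - 1)) holomorphic_on - {1}"
      by (intro holomorphic_intros) (auto intro: holomorphic_on_subset)
    then show ?thesis by (rule holomorphic_transform) (auto simp: f_def)
  qed
  have f: "f s = (\<Sum>n. (of_nat n + of_real a) powr (- s))" if "Re s > 1" for s
  proof -
    have "hurwitz_reg (s, of_real a) = hurwitz_step 0 (s, of_real a)" using that a by (intro hurwitz_reg_eq) (auto simp: hurwitz_domain_def)
    then show ?thesis using that by (auto simp: f_def hurwitz_series_def)
  qed
  have "hurwitz_zeta a = f"
    unfolding hurwitz_zeta_def
  proof (rule the_equality)
    show "f holomorphic_on - {1} \<and> (\<forall>s. Re s > 1 \<longrightarrow> f s = (\<Sum>n. (of_nat n + of_real a) powr (- s))) \<and> f 1 = 0"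
      using holf f by (auto simp: f_def)
    fix g assume g: "g holomorphic_on - {1} \<and> (\<forall>s. Re s > 1 \<longrightarrow> g s = (\<Sum>n. (of_nat n + complex_of_real a) powr (- s))) \<and> g 1 = 0"
    have "g s = f s" if "s \<in> - {1}" for s
    proof (rule analytic_continuation_open[of "{s. Re s > 1}" "- {1}" g f])
      show "connected (- {1 :: complex})" by (rule connected_punctured_universe) simp
      show "{s. Re s > 1} \<noteq> {}" by (auto intro!: exI[of _ 2])
    qed (use g f holf that open_right_half in auto)
    then show "g = f" using g by (auto simp: f_def fun_eq_iff)
  qed
  then show ?thesis by (simp add: f_def)
qed


section \<open>The Mellin transform representation in the critical strip\<close>


text \<open>The subtracted part is the integral of \<open>x powr (- s)\<close> over
  \<open>[b, b + 1]\<close>. What remains is of order \<open>b powr (- s - 1)\<close>, hence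
  summable along \<open>b = n + a\<close>.\<close>

definition hurwitz_term :: "real \<Rightarrow> real \<Rightarrow> real" where
  "hurwitz_term s b = b powr (-s) - ((b + 1) powr (1 - s) - b powr (1 - s)) / (1 - s)"

text \<open>The integrals subtracted in the terms add up formally to that of
  \<open>x powr (- s)\<close> from \<open>a\<close> to infinity, whose continued value is
  \<open>- a powr (1 - s) / (1 - s)\<close>; adding it back restores zeta.\<close>

definition real_hurwitz :: "real \<Rightarrow> real \<Rightarrow> real" where
  "real_hurwitz s a = (\<Sum>n. hurwitz_term s (real n + a)) - a powr (1 - s) / (1 - s)"

lemma hurwitz_term_sums:
  assumes s: "0 < s" "s < 1" and a: "a > 0"
  shows "(\<lambda>n. hurwitz_term s (real n + a)) sums (real_hurwitz s a + a powr (1 - s) / (1 - s))"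
    and hurwitz_reg_of_real: "hurwitz_reg (of_real s, of_real a) = of_real ((s - 1) * real_hurwitz s a)"
proof -
  have e: "(of_real s - 1) * (of_nat n + of_real a) powr (- of_real s) + (of_nat (Suc n) + of_real a) powr (1 - of_real s)
      - (of_nat n + of_real a) powr (1 - of_real s) = complex_of_real ((s - 1) * hurwitz_term s (real n + a))" for n
  proof -
    have "(of_nat n + of_real a :: complex) = of_real (real n + a)" "(of_nat (Suc n) + of_real a :: complex) = of_real (real n + a + 1)"
      "(1 - of_real s :: complex) = of_real (1 - s)" "(- of_real s :: complex) = of_real (- s)" by simp_all
    then have "(of_real s - 1) * (of_nat n + of_real a) powr (- of_real s) + (of_nat (Suc n) + of_real a) powr (1 - of_real s)
      - (of_nat n + of_real a) powr (1 - of_real s) = complex_of_real ((s - 1) * (real n + a) powr (-s) + (real n + a + 1) powr (1 - s) - (real n + a) powr (1 - s))"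
      using a by (simp only: powr_of_real) simp
    also have "(s - 1) * (real n + a) powr (-s) + (real n + a + 1) powr (1 - s) - (real n + a) powr (1 - s) = (s - 1) * hurwitz_term s (real n + a)"
      using s by (simp add: hurwitz_term_def field_simps)
    finally show ?thesis .
  qed
  define X where "X = hurwitz_step 1 (of_real s, of_real a) - of_real a powr (1 - of_real s)"
  have X: "(\<lambda>n. complex_of_real ((s - 1) * hurwitz_term s (real n + a))) sums X"
    using hurwitz_step_1_sums[of "of_real s" "of_real a"] s a unfolding e X_def by simp
  have "Im X = 0"
    using sums_Im[OF X] sums_zero sums_unique2 by (simp only: Im_complex_of_real) blast
  then have XR: "X = of_real (Re X)" by (simp add: complex_eq_iff)
  have R: "(\<lambda>n. (s - 1) * hurwitz_term s (real n + a)) sums Re X"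
    using sums_Re[OF X] by (simp only: Re_complex_of_real)
  have S: "(\<lambda>n. hurwitz_term s (real n + a)) sums (Re X / (s - 1))"
    using sums_divide[OF R, of "s - 1"] s by simp
  then have real_hurwitz: "real_hurwitz s a = Re X / (s - 1) - a powr (1 - s) / (1 - s)"
    by (simp add: real_hurwitz_def sums_iff)
  then show "(\<lambda>n. hurwitz_term s (real n + a)) sums (real_hurwitz s a + a powr (1 - s) / (1 - s))"
    using S by simp
  have "of_real a powr (1 - of_real s) = complex_of_real (a powr (1 - s))"
    using a powr_of_real[of a "1 - s"] by simp
  then have "hurwitz_step 1 (of_real s, of_real a) = of_real (Re X + a powr (1 - s))"
    using XR unfolding X_def by (metis diff_eq_eq of_real_add)
  also have "Re X + a powr (1 - s) = (s - 1) * real_hurwitz s a"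
  proof -
    have "a powr (1 - s) / (1 - s) = - (a powr (1 - s) / (s - 1))"
      by (metis minus_diff_eq minus_divide_right)
    then show ?thesis unfolding real_hurwitz using s by (simp flip: add_divide_distrib)
  qed
  finally show "hurwitz_reg (of_real s, of_real a) = of_real ((s - 1) * real_hurwitz s a)"
    using hurwitz_reg_eq[of "(of_real s, of_real a)" 1] s a by (simp add: hurwitz_domain_def)
qed

section \<open>Mellin integrals of exponentials\<close>

lemma has_integral_Gamma_scaled:
  fixes s b :: real
  assumes s: "s > 0" and b: "b > 0"
  shows "((\<lambda>x. x powr (s - 1) * exp (- b * x)) has_integral (Gamma s * b powr (-s))) {0..}"
proof -
  let ?f = "\<lambda>t::real. t powr (s - 1) / exp t"
  have im: "(\<lambda>x. b * x) ` {0..} = {0..}"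
  proof -
    have "x \<in> (\<lambda>x. b * x) ` {0..}" if "x \<ge> 0" for x
      using that b by (intro image_eqI[of _ _ "x / b"]) auto
    then show ?thesis using b by auto
  qed
  have "?f absolutely_integrable_on {0..}"
    using Gamma_integral_real[OF s] by (intro nonnegative_absolutely_integrable_1) (auto simp: integrable_on_def)
  then have "?f absolutely_integrable_on (\<lambda>x. b * x) ` {0..} \<and> integral ((\<lambda>x. b * x) ` {0..}) ?f = Gamma s"
    using Gamma_integral_real[OF s] by (simp add: im integral_unique)
  moreover have "((\<lambda>x. \<bar>b\<bar> * ?f (b * x)) absolutely_integrable_on {0..} \<and> integral {0..} (\<lambda>x. \<bar>b\<bar> * ?f (b * x)) = Gamma s)
     \<longleftrightarrow> (?f absolutely_integrable_on (\<lambda>x. b * x) ` {0..} \<and> integral ((\<lambda>x. b * x) ` {0..}) ?f = Gamma s)"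
    by (rule has_absolute_integral_change_of_variables_1')
      (use b in \<open>auto intro!: derivative_eq_intros inj_onI\<close>)
  ultimately have "(\<lambda>x. \<bar>b\<bar> * ?f (b * x)) absolutely_integrable_on {0..} \<and> integral {0..} (\<lambda>x. \<bar>b\<bar> * ?f (b * x)) = Gamma s"
    by blast
  then have "((\<lambda>x. b * ?f (b * x)) has_integral Gamma s) {0..}"
    using b by (auto dest!: set_lebesgue_integral_eq_integral(1) simp: has_integral_iff)
  then have "((\<lambda>x. b powr (-s) * (b * ?f (b * x))) has_integral (b powr (-s) * Gamma s)) {0..}"
    by (rule has_integral_mult_right)
  then show ?thesis
  proof (rule has_integral_eq_rhs[OF has_integral_eq, rotated])
    fix x :: real assume "x \<in> {0..}"
    then show "b powr (-s) * (b * ?f (b * x)) = x powr (s - 1) * exp (- b * x)"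
      using b by (simp add: powr_mult powr_diff powr_minus exp_minus field_simps)
  qed simp
qed

text \<open>Integration by parts reduces this to the Gamma integral. The boundary function
  \<open>F\<close> vanishes at both ends, being at most \<open>b * x powr s\<close> near 0 and at
  most \<open>x powr (s - 1)\<close> at infinity. The integrand is nonnegative, so monotone
  convergence passes from finite intervals to the half-line.\<close>

lemma has_integral_powr_one_minus_exp:
  fixes s b :: real
  assumes s: "0 < s" "s < 1" and b: "b > 0"
  shows "((\<lambda>x. x powr (s - 1) * ((1 - exp (- b * x)) / x)) has_integral (Gamma s * b powr (1 - s) / (1 - s))) {0..}"
proof -
  let ?g1 = "\<lambda>x::real. x powr (s - 1) * ((1 - exp (- b * x)) / x)"
  let ?g2 = "\<lambda>x::real. x powr (s - 1) * exp (- b * x)"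
  define F where "F x = x powr (s - 1) * (1 - exp (- b * x))" for x :: real
  define J where "J N = integral {0..real N} ?g2" for N :: nat
  note g2 = has_integral_Gamma_scaled[OF s(1) b]
  have Fb: "norm (F x) \<le> b * x powr s" if "x \<ge> 0" for x
  proof (cases "x = 0")
    case False
    have "1 - exp (- b * x) \<le> b * x" using exp_ge_add_one_self[of "- b * x"] by simp
    then have "F x \<le> x powr (s - 1) * (b * x)" unfolding F_def by (intro mult_left_mono) auto
    also have "\<dots> = b * x powr s" using False that by (simp add: powr_diff)
    finally show ?thesis using that b by (simp add: F_def)
  qed (simp add: F_def)
  \<comment> \<open>The convention \<open>0 powr (s - 1) = 0\<close> gives \<open>F 0 = 0\<close>,
    which agrees with this limit, so \<open>F\<close> is continuous on closed intervals starting at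
    0.\<close>
  have "((\<lambda>x. b * x powr s) \<longlongrightarrow> b * 0) (at 0 within {0..})"
    using s by (intro tendsto_intros) (auto intro!: tendsto_eq_intros simp: eventually_at_filter)
  then have F0: "(F \<longlongrightarrow> 0) (at 0 within {0..})"
    by (intro Lim_null_comparison[of F "\<lambda>x. b * x powr s"])
       (use Fb in \<open>auto simp: eventually_at_filter\<close>)
  have Fc: "continuous_on {0..real N} F" for N
    unfolding continuous_on_def
  proof
    fix x assume x: "x \<in> {0..real N}"
    show "(F \<longlongrightarrow> F x) (at x within {0..real N})"
    proof (cases "x = 0")
      case True
      then show ?thesis using F0 by (auto simp: F_def intro: tendsto_within_subset)
    next
      case False
      then have "isCont F x" unfolding F_def[abs_def] by (intro continuous_intros) auto
      then show ?thesis by (auto simp: isCont_def intro: tendsto_within_subset)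
    qed
  qed
  have F': "((\<lambda>x. b * ?g2 x - (1 - s) * ?g1 x) has_integral (F (real N) - F 0)) {0..real N}" for N
  proof (rule fundamental_theorem_of_calculus_interior[OF _ Fc])
    fix x assume x: "x \<in> {0<..<real N}"
    have "(F has_real_derivative ((s - 1) * x powr (s - 1 - 1) * (1 - exp (- b * x)) + (b * exp (- b * x)) * x powr (s - 1))) (at x)"
      unfolding F_def[abs_def] using x by (auto intro!: derivative_eq_intros)
    also have "x powr (s - 1 - 1) = x powr (s - 1) / x" using x by (subst powr_diff) auto
    also have "(s - 1) * (x powr (s - 1) / x) * (1 - exp (- b * x)) + b * exp (- b * x) * x powr (s - 1) =
        b * ?g2 x - (1 - s) * ?g1 x"
      using x by (simp add: divide_simps) (simp add: algebra_simps)
    finally show "(F has_vector_derivative b * ?g2 x - (1 - s) * ?g1 x) (at x)"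
      unfolding has_real_derivative_iff_has_vector_derivative[symmetric] .
  qed simp
  have g2N: "(?g2 has_integral J N) {0..real N}" for N
    unfolding J_def using g2 
    by (intro integrable_integral integrable_on_subinterval[of ?g2 "{0..}"]) (auto dest: has_integral_integrable)
  have g1N: "(?g1 has_integral ((b * J N - F (real N)) / (1 - s))) {0..real N}" for N
  proof -
    have "((\<lambda>x. (b * ?g2 x - (b * ?g2 x - (1 - s) * ?g1 x)) / (1 - s)) has_integral ((b * J N - (F (real N) - F 0)) / (1 - s))) {0..real N}"
      by (intro has_integral_divide has_integral_diff has_integral_mult_right g2N F')
    then show ?thesis using s by (simp add: F_def)
  qed
  have Jlim: "J \<longlonglongrightarrow> Gamma s * b powr (-s)"
  proof -
    have "(\<lambda>k. integral {0..} (\<lambda>x. if x \<in> {0..real k} then ?g2 x else 0)) \<longlonglongrightarrow> integral {0..} ?g2"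
    proof (rule dominated_convergence(2))
      show "(\<lambda>x. if x \<in> {0..real k} then ?g2 x else 0) integrable_on {0..}" for k
        using g2N[of k] by (intro has_integral_integrable[of _ "J k"]) (subst has_integral_restrict, auto)
      show "?g2 integrable_on {0..}" using g2 by (rule has_integral_integrable)
      show "(\<lambda>k. if x \<in> {0..real k} then ?g2 x else 0) \<longlonglongrightarrow> ?g2 x" if "x \<in> {0..}" for x
      proof (rule tendsto_eventually)
        have "\<forall>\<^sub>F k in sequentially. real k \<ge> x" 
          using filterlim_real_sequentially by (simp add: filterlim_at_top)
        then show "\<forall>\<^sub>F k in sequentially. (if x \<in> {0..real k} then ?g2 x else 0) = ?g2 x"
          by eventually_elim (use that in auto)
      qed
    qed auto
    moreover have "integral {0..} (\<lambda>x. if x \<in> {0..real k} then ?g2 x else 0) = J k" for k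
      using g2N[of k] by (intro integral_unique) (subst has_integral_restrict, auto)
    ultimately show ?thesis using g2 by (simp add: integral_unique)
  qed
  have Flim: "(\<lambda>N. F (real N)) \<longlonglongrightarrow> 0"
  proof (rule Lim_null_comparison)
    show "\<forall>\<^sub>F N in sequentially. norm (F (real N)) \<le> real N powr (- (1 - s))"
      using b by (auto simp: F_def abs_mult intro!: always_eventually mult_left_le)
    show "(\<lambda>N. real N powr (- (1 - s))) \<longlonglongrightarrow> 0"
      using s by (intro tendsto_neg_powr filterlim_real_sequentially) auto
  qed
  show ?thesis
  proof (rule has_integral_monotone_convergence_increasing)
    show "((\<lambda>x. if x \<in> {0..real k} then ?g1 x else 0) has_integral ((b * J k - F (real k)) / (1 - s))) {0..}" for k
      using g1N[of k] by (subst has_integral_restrict) auto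
    show "(if x \<in> {0..real k} then ?g1 x else 0) \<le> (if x \<in> {0..real (Suc k)} then ?g1 x else 0)" if "x \<in> {0..}" for k x
      using that b by auto
    show "(\<lambda>k. if x \<in> {0..real k} then ?g1 x else 0) \<longlonglongrightarrow> ?g1 x" if "x \<in> {0..}" for x
    proof (rule tendsto_eventually)
      have "\<forall>\<^sub>F k in sequentially. real k \<ge> x" 
        using filterlim_real_sequentially by (simp add: filterlim_at_top)
      then show "\<forall>\<^sub>F k in sequentially. (if x \<in> {0..real k} then ?g1 x else 0) = ?g1 x"
        by eventually_elim (use that in auto)
    qed
    have "(\<lambda>k. (b * J k - F (real k)) / (1 - s)) \<longlonglongrightarrow> (b * (Gamma s * b powr (-s)) - 0) / (1 - s)"
      using s by (intro tendsto_intros Jlim Flim) auto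
    also have "b * (Gamma s * b powr (-s)) - 0 = Gamma s * b powr (1 - s)"
      using b by (simp add: powr_diff powr_minus field_simps)
    finally show "(\<lambda>k. (b * J k - F (real k)) / (1 - s)) \<longlonglongrightarrow> Gamma s * b powr (1 - s) / (1 - s)" .
  qed
qed

text \<open>The integral over \<open>[b, b + 1]\<close> in \<open>hurwitz_term\<close> corresponds
  to \<open>exp (- b * x) * (1 - exp (- x)) / x\<close>. It arises as a difference of two integrals
  with \<open>1 - exp\<close> because \<open>exp (- b * x) / x\<close> alone is not integrable
  against \<open>x powr (s - 1)\<close> at 0.\<close>

lemma has_integral_hurwitz_term:
  assumes s: "0 < s" "s < 1" and b: "b > 0"
  shows "((\<lambda>x. x powr (s - 1) * (exp (- b * x) * (1 - (1 - exp (- x)) / x))) has_integral (Gamma s * hurwitz_term s b)) {0..}"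
proof -
  have b1: "b + 1 > 0" using b by simp
  note has_integral_add[OF has_integral_diff[OF has_integral_Gamma_scaled[OF s(1) b] has_integral_powr_one_minus_exp[OF s b1]]
    has_integral_powr_one_minus_exp[OF s b]]
  then show ?thesis
  proof (rule has_integral_eq_rhs[OF has_integral_eq, rotated])
    show "Gamma s * hurwitz_term s b = Gamma s * b powr - s - Gamma s * (b + 1) powr (1 - s) / (1 - s) + Gamma s * b powr (1 - s) / (1 - s)"
      by (simp add: hurwitz_term_def algebra_simps diff_divide_distrib)
  next
    fix x :: real assume "x \<in> {0..}"
    have "exp (- (b + 1) * x) = exp (- b * x) * exp (- x)" by (simp add: algebra_simps flip: exp_add)
    then have "exp (- b * x) - (1 - exp (- (b + 1) * x)) / x + (1 - exp (- b * x)) / x = exp (- b * x) * (1 - (1 - exp (- x)) / x)"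
      by (cases "x = 0") (simp_all add: field_simps)
    then show "x powr (s - 1) * exp (- b * x) - x powr (s - 1) * ((1 - exp (- (b + 1) * x)) / x) + x powr (s - 1) * ((1 - exp (- b * x)) / x)
       = x powr (s - 1) * (exp (- b * x) * (1 - (1 - exp (- x)) / x))"
      by (metis distrib_left right_diff_distrib)
  qed
qed

definition hurwitz_kernel :: "real \<Rightarrow> real \<Rightarrow> real" where
  "hurwitz_kernel a x = exp (- a * x) / (1 - exp (- x)) - 1 / x"

text \<open>The terms have nonnegative integrands, so monotone convergence and the geometric series
  give the transform of their sum. Removing \<open>a powr (1 - s) / (1 - s)\<close> then replaces
  \<open>- exp (- a * x) / x\<close> in the integrand by \<open>- 1 / x\<close>.\<close>

lemma has_integral_real_hurwitz:
  assumes s: "0 < s" "s < 1" and a: "a > 0"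
  shows "((\<lambda>x. x powr (s - 1) * hurwitz_kernel a x) has_integral (Gamma s * real_hurwitz s a)) {0..}"
proof -
  let ?c = "\<lambda>x::real. 1 - (1 - exp (- x)) / x"
  have c: "?c x \<ge> 0" if "x \<ge> 0" for x
    using that exp_ge_add_one_self[of "- x"] by (cases "x = 0") (auto simp: divide_simps)
  let ?S = "real_hurwitz s a + a powr (1 - s) / (1 - s)"
  have 1: "((\<lambda>x. x powr (s - 1) * (exp (- a * x) * (1 / (1 - exp (- x)) - 1 / x))) has_integral (Gamma s * ?S)) {0..}"
  proof (rule has_integral_monotone_convergence_increasing)
    show "((\<lambda>x. \<Sum>n<k. x powr (s - 1) * (exp (- (real n + a) * x) * ?c x)) has_integral (\<Sum>n<k. Gamma s * hurwitz_term s (real n + a))) {0..}" for k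
      using a by (intro has_integral_sum has_integral_hurwitz_term s) auto
    show "(\<Sum>n<k. x powr (s - 1) * (exp (- (real n + a) * x) * ?c x)) \<le> (\<Sum>n<Suc k. x powr (s - 1) * (exp (- (real n + a) * x) * ?c x))"
      if "x \<in> {0..}" for k x
      using c[of x] that by simp
    show "(\<lambda>k. \<Sum>n<k. Gamma s * hurwitz_term s (real n + a)) \<longlonglongrightarrow> Gamma s * ?S"
      using sums_mult[OF hurwitz_term_sums(1)[OF s a], of "Gamma s"] by (simp add: sums_def)
    show "(\<lambda>k. \<Sum>n<k. x powr (s - 1) * (exp (- (real n + a) * x) * ?c x)) \<longlonglongrightarrow> x powr (s - 1) * (exp (- a * x) * (1 / (1 - exp (- x)) - 1 / x))"
      if "x \<in> {0..}" for x
    proof (cases "x = 0")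
      case False
      then have x: "x > 0" using that by simp
      have "(\<lambda>n. exp (- x) ^ n) sums (1 / (1 - exp (- x)))"
        by (rule geometric_sums) (use x in auto)
      from sums_mult[OF this, of "x powr (s - 1) * (exp (- a * x) * ?c x)"]
      have "(\<lambda>n. x powr (s - 1) * (exp (- a * x) * ?c x) * exp (- x) ^ n) sums (x powr (s - 1) * (exp (- a * x) * ?c x) * (1 / (1 - exp (- x))))" .
      also have "(\<lambda>n. x powr (s - 1) * (exp (- a * x) * ?c x) * exp (- x) ^ n) = (\<lambda>n. x powr (s - 1) * (exp (- (real n + a) * x) * ?c x))"
      proof
        fix n
        have "exp (- (real n + a) * x) = exp (- a * x) * exp (- x) ^ n"
          by (simp add: algebra_simps flip: exp_of_nat_mult exp_add)
        then show "x powr (s - 1) * (exp (- a * x) * ?c x) * exp (- x) ^ n = x powr (s - 1) * (exp (- (real n + a) * x) * ?c x)"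
          by (simp only: mult_ac)
      qed
      also have "x powr (s - 1) * (exp (- a * x) * ?c x) * (1 / (1 - exp (- x))) = x powr (s - 1) * (exp (- a * x) * (1 / (1 - exp (- x)) - 1 / x))"
        using x by (simp add: field_simps)
      finally show ?thesis by (simp add: sums_def)
    qed simp
  qed
  have "((\<lambda>x. x powr (s - 1) * (exp (- a * x) * (1 / (1 - exp (- x)) - 1 / x)) - x powr (s - 1) * ((1 - exp (- a * x)) / x))
     has_integral (Gamma s * ?S - Gamma s * a powr (1 - s) / (1 - s))) {0..}"
    by (intro has_integral_diff 1 has_integral_powr_one_minus_exp s a)
  then show ?thesis
  proof (rule has_integral_eq_rhs[OF has_integral_eq, rotated])
    fix x :: real
    have "exp (- a * x) * (1 / (1 - exp (- x)) - 1 / x) - (1 - exp (- a * x)) / x = hurwitz_kernel a x"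
      by (simp add: hurwitz_kernel_def algebra_simps diff_divide_distrib)
    then show "x powr (s - 1) * (exp (- a * x) * (1 / (1 - exp (- x)) - 1 / x)) - x powr (s - 1) * ((1 - exp (- a * x)) / x) = x powr (s - 1) * hurwitz_kernel a x"
      by (metis right_diff_distrib)
  qed (simp add: algebra_simps)
qed


section \<open>Monotonicity in the exponent and in the parameter\<close>


text \<open>A quantitative form of strict negativity. The bound is linear in \<open>c\<close>, so
  that later, with \<open>c\<close> proportional to an increment, it survives division by that
  increment.\<close>

lemma has_integral_le_neg:
  fixes f :: "real \<Rightarrow> real"
  assumes f: "(f has_integral I) {0..}" and nonpos: "\<And>x. x \<ge> 0 \<Longrightarrow> f x \<le> 0"
    and neg: "\<And>x. x \<in> {p..q} \<Longrightarrow> f x \<le> - c" and pq: "0 \<le> p" "p \<le> q"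
  shows "I \<le> - c * (q - p)"
proof (rule has_integral_le[OF f])
  have "((\<lambda>x. - c) has_integral (- c * (q - p))) {p..q}"
    using has_integral_const_real[of "- c" p q] pq by (simp add: mult.commute)
  then show "((\<lambda>x. if x \<in> {p..q} then - c else 0) has_integral (- c * (q - p))) {0..}"
    using pq by (subst has_integral_restrict) auto
  show "f x \<le> (if x \<in> {p..q} then - c else 0)" if "x \<in> {0..}" for x
    using nonpos neg that by auto
qed

lemma continuous_neg_bound:
  fixes f :: "real \<Rightarrow> real"
  assumes "continuous_on {p..q} f" "\<And>x. x \<in> {p..q} \<Longrightarrow> f x < 0" "p \<le> q"
  obtains c where "c > 0" "\<And>x. x \<in> {p..q} \<Longrightarrow> f x \<le> - c"
proof -
  obtain m where m: "m \<in> {p..q}" "\<And>x. x \<in> {p..q} \<Longrightarrow> f x \<le> f m"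
    using continuous_attains_sup[of "{p..q}" f] assms by auto
  show ?thesis using that[of "- f m"] m assms(2) by auto
qed

text \<open>Up to \<open>c\<close> the function rises from 0, so it is positive there; afterwards it
  falls strictly and, being negative at \<open>y\<close>, crosses 0 exactly once. The conclusion has
  the shape of the assumption on \<open>f'\<close>, so the lemma can be iterated.\<close>

lemma single_sign_change:
  fixes f f' :: "real \<Rightarrow> real"
  assumes f0: "f 0 = 0" and f: "\<And>x. x \<ge> 0 \<Longrightarrow> (f has_real_derivative f' x) (at x)"
    and c: "c > 0" "\<And>x. 0 < x \<Longrightarrow> x < c \<Longrightarrow> f' x > 0" "\<And>x. x > c \<Longrightarrow> f' x < 0"
    and y: "y > 0" "f y < 0"
  obtains d where "d > 0" "\<And>x. 0 < x \<Longrightarrow> x < d \<Longrightarrow> f x > 0" "\<And>x. x > d \<Longrightarrow> f x < 0"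
proof -
  have cont: "continuous_on {u..v} f" if "u \<ge> 0" for u v
    using that by (intro continuous_at_imp_continuous_on ballI DERIV_isCont[OF f]) auto
  have inc: "f u < f v" if uv: "0 \<le> u" "u < v" "v \<le> c" for u v
  proof (rule DERIV_pos_imp_increasing_open[OF uv(2) _ cont[OF uv(1)]])
    show "\<exists>y. (f has_real_derivative y) (at x) \<and> 0 < y" if "u < x" "x < v" for x
      using f[of x] c(2)[of x] that uv by (intro exI[of _ "f' x"]) simp
  qed
  have dec: "f v < f u" if uv: "c \<le> u" "u < v" for u v
  proof (rule DERIV_neg_imp_decreasing_open[OF uv(2) _ cont])
    show "\<exists>y. (f has_real_derivative y) (at x) \<and> y < 0" if "u < x" "x < v" for x
      using f[of x] c(1) c(3)[of x] that uv by (intro exI[of _ "f' x"]) simp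
    show "0 \<le> u" using uv c(1) by simp
  qed
  have pos: "f x > 0" if "0 < x" "x \<le> c" for x using inc[of 0 x] that f0 by simp
  have yc: "y > c" using pos[of y] y by force
  have "\<exists>d\<ge>c. d \<le> y \<and> f d = 0"
    by (rule IVT2') (use pos[of c] c y yc cont in auto)
  then obtain d where d: "c \<le> d" "d \<le> y" "f d = 0" by blast
  have dc: "d > c" using pos[of c] c d by (cases "d = c") auto
  show ?thesis
  proof (rule that)
    show "d > 0" using dc c by simp
    show "f x > 0" if "0 < x" "x < d" for x
      using pos[of x] dec[of x d] that d by (cases "x \<le> c") auto
    show "f x < 0" if "x > d" for x using dec[of d x] that d dc by simp
  qed
qed

lemma hurwitz_kernel_eq:
  assumes "x > 0"
  shows "hurwitz_kernel a x = (x - exp (a * x) + exp (- (1 - a) * x)) * (exp (- a * x) / (x * (1 - exp (- x))))"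
    and "exp (- a * x) / (x * (1 - exp (- x))) > 0"
proof -
  have e: "exp (a * x) * exp (- a * x) = 1" "exp (- (1 - a) * x) * exp (- a * x) = exp (- x)"
    by (simp_all add: algebra_simps flip: exp_add)
  have "(x - exp (a * x) + exp (- (1 - a) * x)) * exp (- a * x) = x * exp (- a * x) - 1 + exp (- x)"
    using e by (simp only: ring_distribs)
  moreover have "1 - exp (- x) > 0" using assms by simp
  ultimately show "hurwitz_kernel a x = (x - exp (a * x) + exp (- (1 - a) * x)) * (exp (- a * x) / (x * (1 - exp (- x))))"
    using assms by (simp add: hurwitz_kernel_def field_simps)
  show "exp (- a * x) / (x * (1 - exp (- x))) > 0" using assms by simp
qed

lemma hurwitz_kernel_sign_change:
  assumes a: "0 < a" "a < 1 / 2"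
  obtains d where "d > 0" "\<And>x. 0 < x \<Longrightarrow> x < d \<Longrightarrow> hurwitz_kernel a x > 0" "\<And>x. x > d \<Longrightarrow> hurwitz_kernel a x < 0"
proof -
  define K where "K x = x - exp (a * x) + exp (- (1 - a) * x)" for x
  define K' where "K' x = 1 - a * exp (a * x) - (1 - a) * exp (- (1 - a) * x)" for x
  define K'' where "K'' x = (1 - a)\<^sup>2 * exp (- (1 - a) * x) - a\<^sup>2 * exp (a * x)" for x
  have K: "(K has_real_derivative K' x) (at x)" for x
    unfolding K_def[abs_def] K'_def by (auto intro!: derivative_eq_intros simp: algebra_simps)
  have K': "(K' has_real_derivative K'' x) (at x)" for x
    unfolding K'_def[abs_def] K''_def by (auto intro!: derivative_eq_intros simp: algebra_simps power2_eq_square)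
  \<comment> \<open>The zero of \<open>K''\<close>, which is a positive multiple of
    \<open>exp c - exp x\<close>; it is positive because \<open>a < 1/2\<close>.\<close>
  define c where "c = 2 * ln ((1 - a) / a)"
  have c: "c > 0" "exp c = ((1 - a) / a)\<^sup>2"
    using a exp_double[of "ln ((1 - a) / a)"] by (auto simp: c_def)
  have "K'' x = a\<^sup>2 * exp (- (1 - a) * x) * (exp c - exp x)" for x
  proof -
    have "exp (- (1 - a) * x) * exp x = exp (a * x)" by (simp add: algebra_simps flip: exp_add)
    then have "a\<^sup>2 * exp (- (1 - a) * x) * (exp c - exp x) = a\<^sup>2 * exp c * exp (- (1 - a) * x) - a\<^sup>2 * exp (a * x)"
      by (simp add: algebra_simps)
    also have "a\<^sup>2 * exp c = (1 - a)\<^sup>2" using a by (simp add: c(2) power_divide)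
    finally show ?thesis by (simp add: K''_def)
  qed
  then have K''_sgn: "x < c \<Longrightarrow> K'' x > 0" "x > c \<Longrightarrow> K'' x < 0" for x
    using a by (auto simp: mult_pos_neg)
  \<comment> \<open>Chosen so that \<open>a * exp (a * y1) = 1\<close>: the first two terms of
    \<open>K'\<close> cancel and a negative one remains.\<close>
  define y1 where "y1 = ln (1 / a) / a"
  have "exp (a * y1) = 1 / a" using a by (simp add: y1_def)
  then have y1: "y1 > 0" "K' y1 < 0"
    using a by (auto simp: y1_def K'_def)
  have K0: "K' 0 = 0" "K 0 = 0" by (simp_all add: K_def K'_def)
  obtain c' where c': "c' > 0" "\<And>x. 0 < x \<Longrightarrow> x < c' \<Longrightarrow> K' x > 0" "\<And>x. x > c' \<Longrightarrow> K' x < 0"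
    using single_sign_change[of K' K'' c y1] K' K''_sgn c y1 K0 by metis
  \<comment> \<open>Chosen so that the quadratic Taylor term \<open>(a * y)\<^sup>2 / 2\<close>
    equals \<open>y\<close> and cancels the linear term of \<open>K\<close>, leaving at most
    \<open>- a * y\<close>.\<close>
  define y where "y = 2 / a\<^sup>2"
  have y: "y > 0" using a by (simp add: y_def)
  have "1 + a * y + (a * y)\<^sup>2 / 2 \<le> exp (a * y)"
    using a y by (intro exp_lower_Taylor_quadratic) auto
  also have "(a * y)\<^sup>2 / 2 = y" using a by (simp add: y_def power2_eq_square)
  finally have "K y < 0"
  proof -
    assume *: "1 + a * y + y \<le> exp (a * y)"
    have "exp (- (1 - a) * y) \<le> 1" "a * y > 0" using a y by (auto simp: mult_le_0_iff)
    then show ?thesis using * unfolding K_def by linarith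
  qed
  then obtain d where d: "d > 0" "\<And>x. 0 < x \<Longrightarrow> x < d \<Longrightarrow> K x > 0" "\<And>x. x > d \<Longrightarrow> K x < 0"
    using single_sign_change[of K K' c' y] K c' y K0 by metis
  show ?thesis
  proof (rule that[OF d(1)])
    show "hurwitz_kernel a x > 0" if "0 < x" "x < d" for x
      unfolding hurwitz_kernel_eq(1)[OF that(1)]
      using d(2)[OF that, unfolded K_def] hurwitz_kernel_eq(2)[OF that(1)] by (rule mult_pos_pos)
    show "hurwitz_kernel a x < 0" if "x > d" for x
    proof -
      have "x > 0" using that d(1) by simp
      then show ?thesis unfolding hurwitz_kernel_eq(1)[OF \<open>x > 0\<close>]
        using d(3)[OF that, unfolded K_def] hurwitz_kernel_eq(2)[OF \<open>x > 0\<close>] by (intro mult_neg_pos)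
    qed
  qed
qed

text \<open>The numerator of the kernel is \<open>x - 2 * sinh (x / 2)\<close>, whose derivative is
  \<open>1 - cosh (x / 2) < 0\<close>. The boundary parameter \<open>1/2\<close> provides the
  negative end when \<open>a\<close> is varied for fixed \<open>s\<close>.\<close>

lemma hurwitz_kernel_half_neg: assumes x: "x > 0" shows "hurwitz_kernel (1 / 2) x < 0"
proof -
  define K where "K x = x - exp (x / 2) + exp (- x / 2)" for x :: real
  have "K x < K 0"
  proof (rule DERIV_neg_imp_decreasing_open[OF x])
    fix y :: real assume y: "0 < y" "y < x"
    define t where "t = exp (y / 2)"
    have t: "t > 1" using y by (simp add: t_def)
    have "(t - 1)\<^sup>2 > 0" using t by simp
    then have "2 * t < t * t + 1" by (simp add: power2_eq_square algebra_simps)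
    then have "1 - (t + 1 / t) / 2 < 0" using t by (simp add: field_simps)
    moreover have "(K has_real_derivative (1 - (t + 1 / t) / 2)) (at y)"
      unfolding K_def[abs_def] t_def by (auto intro!: derivative_eq_intros simp: exp_minus field_simps)
    ultimately show "\<exists>z. (K has_real_derivative z) (at y) \<and> z < 0" by blast
  next
    show "continuous_on {0..x} K" unfolding K_def[abs_def] by (intro continuous_intros) auto
  qed
  then have "K x < 0" by (simp add: K_def)
  then have "x - exp (1 / 2 * x) + exp (- (1 - 1 / 2) * x) < 0" by (simp add: K_def)
  then show ?thesis unfolding hurwitz_kernel_eq(1)[OF x, of "1/2"] using hurwitz_kernel_eq(2)[OF x, of "1/2"] by (rule mult_neg_pos)
qed

lemma continuous_on_hurwitz_kernel: "0 < p \<Longrightarrow> continuous_on {p..q} (hurwitz_kernel a)"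
  unfolding hurwitz_kernel_def[abs_def] by (intro continuous_intros) auto

lemma real_hurwitz_half_neg:
  assumes s: "0 < s" "s < 1"
  shows "real_hurwitz s (1 / 2) < 0"
proof -
  have f: "((\<lambda>x. x powr (s - 1) * hurwitz_kernel (1 / 2) x) has_integral (Gamma s * real_hurwitz s (1 / 2))) {0..}"
    using s by (intro has_integral_real_hurwitz) auto
  have neg: "x powr (s - 1) * hurwitz_kernel (1 / 2) x < 0" if "x > 0" for x
    using hurwitz_kernel_half_neg[OF that] that by (simp add: mult_pos_neg)
  have "continuous_on {1..2} (\<lambda>x. x powr (s - 1) * hurwitz_kernel (1 / 2) x)"
    by (intro continuous_intros continuous_on_hurwitz_kernel) auto
  then obtain c where c: "c > 0" "\<And>x. x \<in> {1..2} \<Longrightarrow> x powr (s - 1) * hurwitz_kernel (1 / 2) x \<le> - c"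
    using continuous_neg_bound[of 1 2 "\<lambda>x. x powr (s - 1) * hurwitz_kernel (1 / 2) x"] neg by auto
  have "Gamma s * real_hurwitz s (1 / 2) \<le> - c * (2 - 1)"
  proof (rule has_integral_le_neg[OF f])
    show "x powr (s - 1) * hurwitz_kernel (1 / 2) x \<le> 0" if "x \<ge> 0" for x
      using neg[of x] that by (cases "x = 0") auto
  qed (use c in auto)
  then have "Gamma s * real_hurwitz s (1 / 2) < 0" using c by simp
  then show ?thesis using Gamma_real_pos[OF s(1)] by (simp add: mult_less_0_iff)
qed

text \<open>The difference of the kernels has constant sign, and on \<open>[1, 2]\<close> its
  weighted size is at least proportional to \<open>b - a\<close>, since
  \<open>x powr (s - 1) \<ge> 1/2\<close> and \<open>exp (- b * x) \<ge> exp (- 2 * b)\<close>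
  there. Linearity in \<open>b - a\<close> is what later yields a nonzero derivative.\<close>

lemma real_hurwitz_slope_param:
  assumes s: "0 < s" "s < 1" and ab: "0 < a" "a < b"
  shows "Gamma s * (real_hurwitz s b - real_hurwitz s a) \<le> - (exp (- 2 * b) / 2) * (b - a)"
proof -
  let ?f = "\<lambda>x. x powr (s - 1) * hurwitz_kernel b x - x powr (s - 1) * hurwitz_kernel a x"
  have f: "(?f has_integral (Gamma s * real_hurwitz s b - Gamma s * real_hurwitz s a)) {0..}"
    using s ab by (intro has_integral_diff has_integral_real_hurwitz) auto
  have fe: "?f x = - (x powr (s - 1) * ((exp (- a * x) - exp (- b * x)) / (1 - exp (- x))))" for x
    by (simp add: hurwitz_kernel_def algebra_simps diff_divide_distrib)
  have "Gamma s * real_hurwitz s b - Gamma s * real_hurwitz s a \<le> - (exp (- 2 * b) / 2 * (b - a)) * (2 - 1)"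
  proof (rule has_integral_le_neg[OF f])
    fix x :: real assume "x \<ge> 0"
    then show "?f x \<le> 0" unfolding fe using ab by (auto intro!: mult_nonneg_nonneg divide_nonneg_nonneg mult_right_mono)
  next
    fix x :: real assume x: "x \<in> {1..2}"
    have "x powr (s - 1) \<ge> x powr (- 1)" using x s by (intro powr_mono) auto
    moreover have "x powr (- 1) \<ge> 1 / 2" using x by (simp add: powr_minus field_simps)
    ultimately have 1: "x powr (s - 1) \<ge> 1 / 2" by linarith
    have "exp (- a * x) - exp (- b * x) = exp (- b * x) * (exp ((b - a) * x) - 1)"
      by (simp add: algebra_simps flip: exp_add)
    also have "\<dots> \<ge> exp (- 2 * b) * (b - a)"
    proof (rule mult_mono)
      show "exp (- 2 * b) \<le> exp (- b * x)" using x ab by simp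
      have "b - a \<le> (b - a) * x" using x ab by (simp add: mult_le_cancel_left1)
      also have "\<dots> \<le> exp ((b - a) * x) - 1" using exp_ge_add_one_self[of "(b - a) * x"] by linarith
      finally show "b - a \<le> exp ((b - a) * x) - 1" .
    qed (use ab in auto)
    finally have 2: "exp (- 2 * b) * (b - a) \<le> exp (- a * x) - exp (- b * x)" .
    have "(exp (- a * x) - exp (- b * x)) * 1 \<le> (exp (- a * x) - exp (- b * x)) * (1 / (1 - exp (- x)))"
      using x ab by (intro mult_left_mono) (auto intro!: mult_right_mono)
    then have 3: "exp (- 2 * b) * (b - a) \<le> (exp (- a * x) - exp (- b * x)) / (1 - exp (- x))"
      using 2 by simp
    have "1 / 2 * (exp (- 2 * b) * (b - a)) \<le> x powr (s - 1) * ((exp (- a * x) - exp (- b * x)) / (1 - exp (- x)))"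
      by (rule mult_mono[OF 1 3]) (use ab in auto)
    then show "?f x \<le> - (exp (- 2 * b) / 2 * (b - a))" unfolding fe by simp
  qed auto
  then show ?thesis by (simp add: algebra_simps)
qed

lemma real_hurwitz_strict_antimono_param:
  assumes s: "0 < s" "s < 1" and ab: "0 < a" "a < b"
  shows "real_hurwitz s b < real_hurwitz s a"
proof -
  have "(exp (- 2 * b) / 2) * (b - a) > 0" using ab by simp
  then have "Gamma s * (real_hurwitz s b - real_hurwitz s a) < 0" using real_hurwitz_slope_param[OF assms] by linarith
  then show ?thesis using Gamma_real_pos[OF s(1)] by (simp add: mult_less_0_iff)
qed

text \<open>The weight \<open>d powr (- s)\<close> moves the sign change of the kernel to the point where
  \<open>(x / d) powr s\<close> stops decreasing and starts increasing in \<open>s\<close>.\<close>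

lemma real_hurwitz_slope_exponent:
  assumes a: "0 < a" "a < 1 / 2"
  obtains c d where "c > 0" "d > 0"
    "\<And>s t. 0 < s \<Longrightarrow> s < t \<Longrightarrow> t < 1 \<Longrightarrow>
       d powr (-t) * (Gamma t * real_hurwitz t a) - d powr (-s) * (Gamma s * real_hurwitz s a) \<le> - c * (t - s)"
proof -
  obtain d where d: "d > 0" "\<And>x. 0 < x \<Longrightarrow> x < d \<Longrightarrow> hurwitz_kernel a x > 0" "\<And>x. x > d \<Longrightarrow> hurwitz_kernel a x < 0"
    using hurwitz_kernel_sign_change[OF a] by blast
  \<comment> \<open>On this compact window beyond \<open>d\<close> the kernel is bounded away from
    0, and \<open>x / d \<ge> 2\<close> makes the difference of the powers at least
    \<open>(t - s) * ln 2\<close>. The divisor \<open>x\<close> is at most \<open>3 * d\<close>, and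
    the window has length \<open>d\<close>.\<close>
  obtain m where m: "m > 0" "\<And>x. x \<in> {2 * d..3 * d} \<Longrightarrow> hurwitz_kernel a x \<le> - m"
    using continuous_neg_bound[OF continuous_on_hurwitz_kernel[of "2 * d" "3 * d" a]] d by auto
  define c where "c = m * (ln 2 / (3 * d))"
  have c: "c > 0" using m d by (simp add: c_def)
  have "d powr (-t) * (Gamma t * real_hurwitz t a) - d powr (-s) * (Gamma s * real_hurwitz s a) \<le> - (c * d) * (t - s)"
    if st: "0 < s" "s < t" "t < 1" for s t
  proof -
    let ?f = "\<lambda>x. d powr (-t) * (x powr (t - 1) * hurwitz_kernel a x) - d powr (-s) * (x powr (s - 1) * hurwitz_kernel a x)"
    have f: "(?f has_integral (d powr (-t) * (Gamma t * real_hurwitz t a) - d powr (-s) * (Gamma s * real_hurwitz s a))) {0..}"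
      using st a by (intro has_integral_diff has_integral_mult_right has_integral_real_hurwitz) auto
    have fe: "?f x = hurwitz_kernel a x * (((x / d) powr t - (x / d) powr s) / x)" if "x > 0" for x
      using that d(1) by (simp add: powr_divide powr_minus powr_diff field_simps)
    have "d powr (-t) * (Gamma t * real_hurwitz t a) - d powr (-s) * (Gamma s * real_hurwitz s a) \<le> - (c * (t - s)) * (3 * d - 2 * d)"
    proof (rule has_integral_le_neg[OF f])
      fix x :: real assume x0: "x \<ge> 0"
      show "?f x \<le> 0"
      proof (cases "x = 0")
        case False
        then have x: "x > 0" using x0 by simp
        consider "x < d" | "x = d" | "x > d" by linarith
        then show ?thesis
        proof cases
          case 1
          then have "(x / d) powr t \<le> (x / d) powr s" using x d(1) st by (intro powr_mono') auto
          then show ?thesis unfolding fe[OF x] using d(2)[OF x 1] x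
            by (intro mult_nonneg_nonpos) (auto simp: divide_nonpos_pos)
        next
          case 2
          then show ?thesis unfolding fe[OF x] using d(1) by simp
        next
          case 3
          then have "(x / d) powr t \<ge> (x / d) powr s" using x d(1) st by (intro powr_mono) auto
          then show ?thesis unfolding fe[OF x] using d(3)[OF 3] x
            by (intro mult_nonpos_nonneg) auto
        qed
      qed simp
    next
      fix x assume x: "x \<in> {2 * d..3 * d}"
      then have x0: "x > 0" using d(1) by (auto intro: less_le_trans[of 0 "2 * d"])
      define r where "r = x / d"
      have r: "r \<ge> 2" using x d(1) by (simp add: r_def field_simps)
      have "(t - s) * ln 2 \<le> (t - s) * ln r" using r st by (intro mult_left_mono) auto
      also have "\<dots> \<le> r powr (t - s) - 1"
      proof -
        have "r powr (t - s) = exp ((t - s) * ln r)" using r by (simp add: powr_def)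
        then show ?thesis using exp_ge_add_one_self[of "(t - s) * ln r"] by linarith
      qed
      also have "\<dots> \<le> r powr s * (r powr (t - s) - 1)"
      proof -
        have "1 \<le> r powr s" "1 \<le> r powr (t - s)" using r st by (auto intro!: ge_one_powr_ge_zero)
        then show ?thesis by (simp add: mult_le_cancel_right1)
      qed
      also have "\<dots> = r powr t - r powr s" by (simp add: right_diff_distrib flip: powr_add)
      finally have 1: "(t - s) * ln 2 \<le> r powr t - r powr s" .
      have "(t - s) * ln 2 / (3 * d) \<le> (r powr t - r powr s) / x"
      proof (rule frac_le)
        have "0 \<le> (t - s) * ln 2" using st by simp
        then show "0 \<le> r powr t - r powr s" using 1 by linarith
      qed (use 1 x x0 in auto)
      then have "m * ((t - s) * ln 2 / (3 * d)) \<le> (- hurwitz_kernel a x) * ((r powr t - r powr s) / x)"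
        using m(2)[OF x] m(1) st d(1) by (intro mult_mono) auto
      then show "?f x \<le> - (c * (t - s))"
        unfolding fe[OF x0] by (simp add: c_def r_def mult_ac)
    qed (use d(1) in auto)
    then show ?thesis by (simp add: algebra_simps)
  qed
  then show ?thesis using that[of "c * d" d] c d(1) by simp
qed

text \<open>The weights \<open>d powr (- s) * Gamma s\<close> are positive, so the strictly
  decreasing weighted function has the same signs as \<open>real_hurwitz\<close>.\<close>

lemma real_hurwitz_exponent_sign:
  assumes a: "0 < a" "a < 1 / 2" and st: "0 < s" "s < t" "t < 1"
  shows "real_hurwitz s a \<le> 0 \<Longrightarrow> real_hurwitz t a < 0" and "real_hurwitz t a \<ge> 0 \<Longrightarrow> real_hurwitz s a > 0"
proof -
  obtain c d where cd: "c > 0" "d > 0"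
    "\<And>s t. 0 < s \<Longrightarrow> s < t \<Longrightarrow> t < 1 \<Longrightarrow>
       d powr (-t) * (Gamma t * real_hurwitz t a) - d powr (-s) * (Gamma s * real_hurwitz s a) \<le> - c * (t - s)"
    using real_hurwitz_slope_exponent[OF a] by blast
  have "- c * (t - s) < 0" using cd st by (simp add: mult_neg_pos)
  then have *: "d powr (-t) * (Gamma t * real_hurwitz t a) < d powr (-s) * (Gamma s * real_hurwitz s a)"
    using cd(3)[OF st] by linarith
  have G: "Gamma s > 0" "Gamma t > 0" "d powr (-s) > 0" "d powr (-t) > 0" using st cd by auto
  show "real_hurwitz t a < 0" if "real_hurwitz s a \<le> 0"
  proof (rule ccontr)
    assume "\<not> real_hurwitz t a < 0"
    then have "d powr (-t) * (Gamma t * real_hurwitz t a) \<ge> 0" using G by simp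
    moreover have "d powr (-s) * (Gamma s * real_hurwitz s a) \<le> 0" using G that by (simp add: mult_nonneg_nonpos)
    ultimately show False using * by linarith
  qed
  show "real_hurwitz s a > 0" if "real_hurwitz t a \<ge> 0"
  proof (rule ccontr)
    assume "\<not> real_hurwitz s a > 0"
    then have "d powr (-s) * (Gamma s * real_hurwitz s a) \<le> 0" using G by (simp add: mult_nonneg_nonpos)
    moreover have "d powr (-t) * (Gamma t * real_hurwitz t a) \<ge> 0" using G that by simp
    ultimately show False using * by linarith
  qed
qed

text \<open>The lower bound \<open>k\<close> may vary with \<open>t\<close>, as do the weights
  divided out of the slope estimates; only its limit has to be positive.\<close>

lemma has_real_derivative_pos:
  assumes g: "(g has_real_derivative D) (at x)"
    and k: "(k \<longlongrightarrow> L) (at_right x)" "L > 0"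
    and le: "\<forall>\<^sub>F t in at_right x. k t \<le> (g t - g x) / (t - x)"
  shows "D > 0"
proof -
  have "((\<lambda>t. (g t - g x) / (t - x)) \<longlongrightarrow> D) (at_right x)"
    using g unfolding has_field_derivative_iff by (rule tendsto_mono[rotated]) (simp add: at_le)
  from tendsto_le[OF _ this k(1) le] have "L \<le> D" by simp
  then show ?thesis using k(2) by simp
qed

lemma hurwitz_reg_real_derivative:
  fixes u v :: "real \<Rightarrow> real"
  assumes "(u has_real_derivative u') (at t)" "(v has_real_derivative v') (at t)" "v t > 0"
  shows "((\<lambda>t. hurwitz_reg (of_real (u t), of_real (v t))) has_vector_derivative
     (partial_fst hurwitz_reg (of_real (u t), of_real (v t)) * of_real u' + partial_snd hurwitz_reg (of_real (u t), of_real (v t)) * of_real v')) (at t)"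
  by (rule sep_hol_chain[OF sep_hol_hurwitz_reg, where u = "\<lambda>t. of_real (u t)" and v = "\<lambda>t. of_real (v t)"])
    (use assms in \<open>auto intro: has_vector_derivative_of_real simp: has_real_derivative_iff_has_vector_derivative\<close>)

lemma Re_hurwitz_reg_real_derivative:
  fixes u v :: "real \<Rightarrow> real"
  assumes "(u has_real_derivative u') (at t)" "(v has_real_derivative v') (at t)" "v t > 0"
  shows "((\<lambda>t. Re (hurwitz_reg (of_real (u t), of_real (v t)))) has_real_derivative
     Re (partial_fst hurwitz_reg (of_real (u t), of_real (v t)) * of_real u' + partial_snd hurwitz_reg (of_real (u t), of_real (v t)) * of_real v')) (at t)"
  using bounded_linear.has_vector_derivative[OF bounded_linear_Re hurwitz_reg_real_derivative[OF assms]]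
  by (simp add: has_real_derivative_iff_has_vector_derivative)

lemma partial_snd_hurwitz_reg_nonzero:
  assumes s: "0 < s" "s < 1" and a: "a > 0"
  shows "partial_snd hurwitz_reg (of_real s, of_real a) \<noteq> 0"
proof -
  have "((\<lambda>t. Re (hurwitz_reg (of_real s, of_real t))) has_real_derivative Re (partial_snd hurwitz_reg (of_real s, of_real a))) (at a)"
    using Re_hurwitz_reg_real_derivative[of "\<lambda>_. s" 0 a "\<lambda>t. t" 1] a by simp
  moreover have "((\<lambda>b. (1 - s) * (exp (- 2 * b) / 2) / Gamma s) \<longlongrightarrow> (1 - s) * (exp (- 2 * a) / 2) / Gamma s) (at_right a)"
    using Gamma_real_pos[OF s(1)] by (intro tendsto_intros) auto
  ultimately have "Re (partial_snd hurwitz_reg (of_real s, of_real a)) > 0"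
  proof (rule has_real_derivative_pos)
    show "(1 - s) * (exp (- 2 * a) / 2) / Gamma s > 0" using s Gamma_real_pos[OF s(1)] by simp
    have "\<forall>\<^sub>F b in at_right a. b > a" by (simp add: eventually_at_filter)
    then show "\<forall>\<^sub>F b in at_right a. (1 - s) * (exp (- 2 * b) / 2) / Gamma s \<le>
        (Re (hurwitz_reg (of_real s, of_real b)) - Re (hurwitz_reg (of_real s, of_real a))) / (b - a)"
    proof eventually_elim
      case (elim b)
      have "Gamma s * (real_hurwitz s b - real_hurwitz s a) \<le> - (exp (- 2 * b) / 2) * (b - a)"
        by (rule real_hurwitz_slope_param[OF s a elim])
      then have "(1 - s) * ((exp (- 2 * b) / 2) * (b - a)) \<le> (1 - s) * (Gamma s * (real_hurwitz s a - real_hurwitz s b))"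
        using s by (intro mult_left_mono) (auto simp: algebra_simps)
      also have "\<dots> = Gamma s * ((s - 1) * real_hurwitz s b - (s - 1) * real_hurwitz s a)" by (simp add: algebra_simps)
      finally have "(1 - s) * ((exp (- 2 * b) / 2) * (b - a)) \<le> Gamma s * ((s - 1) * real_hurwitz s b - (s - 1) * real_hurwitz s a)" .
      then show ?case using elim a Gamma_real_pos[OF s(1)]
        by (simp add: hurwitz_reg_of_real[OF s] divide_le_eq le_divide_eq mult_ac)
    qed
  qed
  then show ?thesis by auto
qed

text \<open>At a zero the weighted value at \<open>s\<close> vanishes, so the slope estimate for the
  weighted function bounds \<open>real_hurwitz t a\<close> itself, and dividing by the weight at
  \<open>t\<close> bounds the difference quotient.\<close>

lemma partial_fst_hurwitz_reg_nonzero: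
  assumes s: "0 < s" "s < 1" and a: "0 < a" "a < 1 / 2" and zero: "real_hurwitz s a = 0"
  shows "partial_fst hurwitz_reg (of_real s, of_real a) \<noteq> 0"
proof -
  obtain c d where cd: "c > 0" "d > 0"
    "\<And>s t. 0 < s \<Longrightarrow> s < t \<Longrightarrow> t < 1 \<Longrightarrow>
       d powr (-t) * (Gamma t * real_hurwitz t a) - d powr (-s) * (Gamma s * real_hurwitz s a) \<le> - c * (t - s)"
    using real_hurwitz_slope_exponent[OF a] by blast
  have "((\<lambda>t. Re (hurwitz_reg (of_real t, of_real a))) has_real_derivative Re (partial_fst hurwitz_reg (of_real s, of_real a))) (at s)"
    using Re_hurwitz_reg_real_derivative[of "\<lambda>t. t" 1 s "\<lambda>_. a" 0] a by simp
  moreover have "((\<lambda>t. (1 - t) * c / (d powr (-t) * Gamma t)) \<longlongrightarrow> (1 - s) * c / (d powr (-s) * Gamma s)) (at_right s)"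
    using Gamma_real_pos[OF s(1)] cd s
    by (intro tendsto_intros) (auto elim!: nonpos_Ints_cases simp del: Gamma_real_pos)
  ultimately have "Re (partial_fst hurwitz_reg (of_real s, of_real a)) > 0"
  proof (rule has_real_derivative_pos)
    show "(1 - s) * c / (d powr (-s) * Gamma s) > 0" using s cd Gamma_real_pos[OF s(1)] by simp
    have "\<forall>\<^sub>F t in at_right s. t > s" by (simp add: eventually_at_filter)
    moreover have "\<forall>\<^sub>F t in at_right s. t < 1"
      using s(2) eventually_at_right_less order_tendstoD(2)[OF tendsto_ident_at] by blast
    ultimately show "\<forall>\<^sub>F t in at_right s. (1 - t) * c / (d powr (-t) * Gamma t) \<le>
        (Re (hurwitz_reg (of_real t, of_real a)) - Re (hurwitz_reg (of_real s, of_real a))) / (t - s)"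
    proof eventually_elim
      case (elim t)
      have t: "0 < t" "t < 1" using elim s by auto
      have P: "d powr (-t) * Gamma t > 0" using Gamma_real_pos[OF t(1)] cd by simp
      have "d powr (-t) * (Gamma t * real_hurwitz t a) \<le> - c * (t - s)"
        using cd(3)[OF s(1) elim] zero by simp
      then have "(1 - t) * (c * (t - s)) \<le> (1 - t) * (- (d powr (-t) * (Gamma t * real_hurwitz t a)))"
        using t by (intro mult_left_mono) auto
      also have "\<dots> = (d powr (-t) * Gamma t) * ((t - 1) * real_hurwitz t a)" by (simp add: algebra_simps)
      finally have "(1 - t) * (c * (t - s)) \<le> (d powr (-t) * Gamma t) * ((t - 1) * real_hurwitz t a)" .
      then show ?case using elim P
        by (simp add: hurwitz_reg_of_real[OF t a(1)] hurwitz_reg_of_real[OF s a(1)] zero divide_le_eq le_divide_eq mult_ac)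
    qed
  qed
  then show ?thesis by auto
qed


section \<open>The zero as a function of the parameter\<close>


lemma hurwitz_zeta_of_real:
  assumes "0 < s" "s < 1" "a > 0"
  shows "hurwitz_zeta a (of_real s) = of_real (real_hurwitz s a)"
proof -
  have "complex_of_real s \<noteq> 1" using assms by simp
  moreover have "complex_of_real s - 1 = of_real (s - 1)" by simp
  ultimately show ?thesis using assms by (simp add: hurwitz_zeta_eq hurwitz_reg_of_real)
qed

lemma real_hurwitz_zero_exists:
  assumes a: "0 < a" "a < 1 / 2"
  obtains s where "0 < s" "s < 1" "real_hurwitz s a = 0"
proof -
  let ?g = "\<lambda>t. Re (hurwitz_reg (of_real t, of_real a))"
  have "isCont ?g t" for t
    using Re_hurwitz_reg_real_derivative[of "\<lambda>t. t" 1 t "\<lambda>_. a" 0] a by (auto intro: DERIV_isCont)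
  then have c: "continuous_on {0..1} ?g" by (intro continuous_at_imp_continuous_on) auto
  have g: "?g 0 < 0" "?g 1 = 1" using a by (simp_all add: hurwitz_reg_0 hurwitz_reg_1)
  have "\<exists>s\<ge>0. s \<le> 1 \<and> ?g s = 0" by (rule IVT') (use g c in auto)
  then obtain s where s: "0 \<le> s" "s \<le> 1" "?g s = 0" by blast
  have "s \<noteq> 0" "s \<noteq> 1" using s g by auto
  then have "0 < s" "s < 1" using s by auto
  then show ?thesis using that[of s] s a by (simp add: hurwitz_reg_of_real)
qed

lemma real_hurwitz_zero_unique:
  assumes "0 < a" "a < 1 / 2" "0 < s" "s < 1" "0 < t" "t < 1" "real_hurwitz s a = 0" "real_hurwitz t a = 0"
  shows "s = t"
  using real_hurwitz_exponent_sign(1)[of a s t] real_hurwitz_exponent_sign(1)[of a t s] assms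
  by (cases s t rule: linorder_cases) auto

lemma hurwitz_beta:
  assumes a: "0 < a" "a < 1 / 2"
  shows "0 < hurwitz_beta a" "hurwitz_beta a < 1" "real_hurwitz (hurwitz_beta a) a = 0"
proof -
  obtain s where s: "0 < s" "s < 1" "real_hurwitz s a = 0" using real_hurwitz_zero_exists[OF a] .
  have "hurwitz_beta a = s"
    unfolding hurwitz_beta_def
    by (rule the_equality) (use a s real_hurwitz_zero_unique[OF a] in \<open>auto simp: hurwitz_zeta_of_real\<close>)
  then show "0 < hurwitz_beta a" "hurwitz_beta a < 1" "real_hurwitz (hurwitz_beta a) a = 0" using s by auto
qed

lemma hurwitz_beta_eqI:
  assumes "0 < a" "a < 1 / 2" "0 < s" "s < 1" "real_hurwitz s a = 0"
  shows "hurwitz_beta a = s"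
  using real_hurwitz_zero_unique[of a "hurwitz_beta a" s] hurwitz_beta[of a] assms by auto

section \<open>Elementary bounds and the range of the zero\<close>

lemma hurwitz_term_bounds:
  assumes s: "0 < s" "s < 1" and b: "b > 0"
  shows "0 \<le> hurwitz_term s b" "hurwitz_term s b \<le> b powr (-s) - (b + 1) powr (-s)"
proof -
  \<comment> \<open>The mean value theorem replaces the integral over \<open>[b, b + 1]\<close> by
    \<open>z powr (- s)\<close> at an intermediate point; monotonicity of the power then gives both
    bounds.\<close>
  have "\<exists>z>b. z < b + 1 \<and> (b + 1) powr (1 - s) - b powr (1 - s) = (b + 1 - b) * ((1 - s) * z powr (1 - s - 1))"
    by (rule MVT2) (use b in \<open>auto intro!: derivative_eq_intros\<close>)
  then obtain z where z: "b < z" "z < b + 1" "(b + 1) powr (1 - s) - b powr (1 - s) = (1 - s) * z powr (-s)"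
    by auto
  have "hurwitz_term s b = b powr (-s) - z powr (-s)" using s by (simp add: hurwitz_term_def z(3))
  moreover have "z powr (-s) \<le> b powr (-s)" "(b + 1) powr (-s) \<le> z powr (-s)"
    using z b s by (auto intro!: powr_mono2')
  ultimately show "0 \<le> hurwitz_term s b" "hurwitz_term s b \<le> b powr (-s) - (b + 1) powr (-s)" by auto
qed

text \<open>The first term is split off because it alone is singular as \<open>a\<close> tends to 0;
  the rest is zeta at parameter \<open>a + 1\<close>. A telescoping majorant bounds its series
  \<open>T\<close> uniformly in \<open>s\<close> and \<open>a\<close>.\<close>

lemma real_hurwitz_decompose:
  assumes s: "0 < s" "s < 1" and a: "a > 0"
  obtains T where "0 \<le> T" "T \<le> 1" "real_hurwitz s a = a powr (-s) - (a + 1) powr (1 - s) / (1 - s) + T"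
proof -
  define T where "T = (\<Sum>n. hurwitz_term s (real n + (a + 1)))"
  have a1: "a + 1 > 0" using a by simp
  have S: "(\<lambda>n. hurwitz_term s (real n + (a + 1))) sums T"
    using hurwitz_term_sums[OF s a1] unfolding T_def by (simp add: sums_iff)
  have "(\<lambda>n. hurwitz_term s (real (Suc n) + a)) sums T" using S by (simp add: add_ac)
  then have "(\<lambda>n. hurwitz_term s (real n + a)) sums (T + hurwitz_term s (real 0 + a))" by (rule sums_Suc)
  then have "real_hurwitz s a = T + hurwitz_term s a - a powr (1 - s) / (1 - s)"
    unfolding real_hurwitz_def by (simp add: sums_iff)
  then have e: "real_hurwitz s a = a powr (-s) - (a + 1) powr (1 - s) / (1 - s) + T"
    by (simp add: hurwitz_term_def diff_divide_distrib)
  have T0: "0 \<le> T" using sums_le[OF _ sums_zero S] hurwitz_term_bounds(1)[OF s] a by simp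
  have "filterlim (\<lambda>n. (a + 1) + real n) at_top sequentially"
    by (rule filterlim_tendsto_add_at_top[OF tendsto_const filterlim_real_sequentially])
  then have "((\<lambda>n. ((a + 1) + real n) powr (-s)) \<longlongrightarrow> 0) sequentially"
    using s by (intro tendsto_neg_powr) auto
  then have "((\<lambda>n. (real n + (a + 1)) powr (-s)) \<longlongrightarrow> 0) sequentially"
    by (simp only: add.commute[of _ "a + 1"])
  from telescope_sums'[OF this]
  have tele: "(\<lambda>n. (real n + (a + 1)) powr (-s) - (real (Suc n) + (a + 1)) powr (-s)) sums ((a + 1) powr (-s))" by simp
  have "T \<le> (a + 1) powr (-s)"
  proof (rule sums_le[OF _ S tele])
    show "hurwitz_term s (real n + (a + 1)) \<le> (real n + (a + 1)) powr (-s) - (real (Suc n) + (a + 1)) powr (-s)" for n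
      using hurwitz_term_bounds(2)[OF s, of "real n + (a + 1)"] a by (simp add: add_ac)
  qed
  also have "\<dots> \<le> 1 powr (-s)" using a s by (intro powr_mono2') auto
  finally show ?thesis using that[OF T0 _ e] by simp
qed

lemma hurwitz_beta_surj:
  assumes s: "0 < s" "s < 1"
  obtains a where "0 < a" "a < 1 / 2" "hurwitz_beta a = s"
proof -
  \<comment> \<open>The term \<open>2 / (1 - s)\<close> bounds
    \<open>(a1 + 1) powr (1 - s) / (1 - s)\<close>, so \<open>a1 powr (- s) = y\<close> makes the
    value at \<open>a1\<close> positive; \<open>y > 3\<close> gives
    \<open>a1 \<le> 1 / y < 1 / 2\<close>.\<close>
  define y where "y = 2 / (1 - s) + 1"
  define a1 where "a1 = y powr (- 1 / s)"
  have y: "y > 3" using s by (simp add: y_def divide_simps)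
  have a1: "0 < a1" "a1 powr (-s) = y" using y s by (auto simp: a1_def powr_powr)
  have "a1 \<le> y powr (- 1)" unfolding a1_def using y s by (intro powr_mono) (auto simp: field_simps)
  also have "\<dots> < 1 / 2" using y by (simp add: powr_minus field_simps)
  finally have a1h: "a1 < 1 / 2" .
  obtain T where T: "0 \<le> T" "real_hurwitz s a1 = a1 powr (-s) - (a1 + 1) powr (1 - s) / (1 - s) + T"
    using real_hurwitz_decompose[OF s a1(1)] by metis
  have "(a1 + 1) powr (1 - s) \<le> (a1 + 1) powr 1" using a1 s by (intro powr_mono) auto
  then have "(a1 + 1) powr (1 - s) / (1 - s) \<le> 2 / (1 - s)" using a1 a1h s by (intro divide_right_mono) auto
  then have pos: "real_hurwitz s a1 > 0" using T a1 by (simp add: y_def)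
  let ?g = "\<lambda>t. Re (hurwitz_reg (of_real s, of_real t))"
  have "isCont ?g t" if "t > 0" for t
    using Re_hurwitz_reg_real_derivative[of "\<lambda>_. s" 0 t "\<lambda>t. t" 1] that by (auto intro: DERIV_isCont)
  then have c: "continuous_on {a1..1/2} ?g" using a1 by (intro continuous_at_imp_continuous_on) auto
  have g: "?g t = (s - 1) * real_hurwitz s t" if "t > 0" for t using that s by (simp add: hurwitz_reg_of_real)
  \<comment> \<open>The factor \<open>s - 1\<close> is negative, so the signs at the two ends are
    those of \<open>real_hurwitz\<close> reversed.\<close>
  have "\<exists>a\<ge>a1. a \<le> 1 / 2 \<and> ?g a = 0"
  proof (rule IVT')
    show "?g a1 \<le> 0" using g[of a1] a1 pos s by (simp add: mult_nonpos_nonneg)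
    show "0 \<le> ?g (1 / 2)" using g[of "1/2"] real_hurwitz_half_neg[OF s] s by (simp add: mult_nonpos_nonpos)
  qed (use c a1h in auto)
  then obtain a where a: "a1 \<le> a" "a \<le> 1 / 2" "?g a = 0" by blast
  have a0: "a > 0" using a a1 by simp
  then have z: "real_hurwitz s a = 0" using g[OF a0] a s by simp
  then have "a \<noteq> 1 / 2" using real_hurwitz_half_neg[OF s] by (metis less_irrefl)
  then have "a < 1 / 2" using a by simp
  then show ?thesis using that[of a] hurwitz_beta_eqI[of a s] a0 z s by simp
qed

lemma hurwitz_beta_antimono:
  assumes "0 < a" "a < b" "b < 1 / 2"
  shows "hurwitz_beta b < hurwitz_beta a"
proof (rule ccontr)
  let ?s = "hurwitz_beta a" and ?t = "hurwitz_beta b"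
  have a: "0 < ?s" "?s < 1" "real_hurwitz ?s a = 0" using hurwitz_beta[of a] assms by auto
  have b: "0 < ?t" "?t < 1" "real_hurwitz ?t b = 0" using hurwitz_beta[of b] assms by auto
  assume "\<not> ?t < ?s"
  moreover have neg: "real_hurwitz ?s b < 0" using real_hurwitz_strict_antimono_param[OF a(1,2) assms(1,2)] a by simp
  ultimately have "?s < ?t" using b by (cases "?s = ?t") auto
  then have "real_hurwitz ?s b > 0" using real_hurwitz_exponent_sign(2)[of b ?s ?t] assms a b by auto
  then show False using neg by simp
qed

section \<open>Bijectivity and continuity in both directions\<close>

abbreviation "beta_inv \<equiv> inv_into {0<..<1/2} hurwitz_beta"

lemma bij_hurwitz_beta: "bij_betw hurwitz_beta {0<..<1/2} {0<..<1}"
  unfolding bij_betw_def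
proof
  show "inj_on hurwitz_beta {0<..<1/2}"
  proof (rule inj_onI)
    fix x y assume "x \<in> {0<..<1/2::real}" "y \<in> {0<..<1/2}" "hurwitz_beta x = hurwitz_beta y"
    then show "x = y"
      using hurwitz_beta_antimono[of x y] hurwitz_beta_antimono[of y x] by (cases x y rule: linorder_cases) auto
  qed
  show "hurwitz_beta ` {0<..<1/2} = {0<..<1}"
  proof
    show "hurwitz_beta ` {0<..<1/2} \<subseteq> {0<..<1}" using hurwitz_beta by auto
    show "{0<..<1} \<subseteq> hurwitz_beta ` {0<..<1/2}"
    proof
      fix s :: real assume "s \<in> {0<..<1}"
      then obtain a where "0 < a" "a < 1 / 2" "hurwitz_beta a = s" using hurwitz_beta_surj[of s] by auto
      then show "s \<in> hurwitz_beta ` {0<..<1/2}" by auto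
    qed
  qed
qed

lemma beta_inv:
  assumes "0 < s" "s < 1"
  shows "0 < beta_inv s" "beta_inv s < 1 / 2" "hurwitz_beta (beta_inv s) = s"
proof -
  have "s \<in> hurwitz_beta ` {0<..<1/2}" using bij_hurwitz_beta assms by (auto simp: bij_betw_def)
  from inv_into_into[OF this] f_inv_into_f[OF this]
  show "0 < beta_inv s" "beta_inv s < 1 / 2" "hurwitz_beta (beta_inv s) = s" by auto
qed

text \<open>A monotone function can be discontinuous only through a jump, which an open interval as
  image rules out. Negation turns the decreasing function into an increasing one.\<close>

lemma isCont_antimono_bij:
  fixes f :: "real \<Rightarrow> real"
  assumes im: "f ` {p<..<q} = {u<..<v}" and anti: "\<And>x y. p < x \<Longrightarrow> x \<le> y \<Longrightarrow> y < q \<Longrightarrow> f y \<le> f x"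
    and x: "x \<in> {p<..<q}"
  shows "isCont f x"
proof -
  have "continuous_on {p<..<q} (\<lambda>x. - f x)"
  proof (rule continuous_onI_mono)
    have "(\<lambda>x. - f x) ` {p<..<q} = uminus ` {u<..<v}" by (simp flip: im add: image_image)
    then show "open ((\<lambda>x. - f x) ` {p<..<q})" by simp
  qed (use anti in auto)
  then have "continuous_on {p<..<q} (\<lambda>x. - (- f x))" by (rule continuous_on_minus)
  then show ?thesis using x by (simp add: continuous_on_eq_continuous_at)
qed

lemma isCont_hurwitz_beta: "0 < a \<Longrightarrow> a < 1 / 2 \<Longrightarrow> isCont hurwitz_beta a"
  by (rule isCont_antimono_bij[of _ 0 "1/2" 0 1])
    (use bij_hurwitz_beta hurwitz_beta_antimono in \<open>auto simp: bij_betw_def order_le_less\<close>)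

lemma isCont_beta_inv:
  assumes "0 < s" "s < 1" shows "isCont beta_inv s"
proof (rule isCont_antimono_bij[of _ 0 1 0 "1/2"])
  show "beta_inv ` {0<..<1} = {0<..<1/2}"
    using bij_betw_inv_into[OF bij_hurwitz_beta] by (simp add: bij_betw_def)
  show "beta_inv y \<le> beta_inv x" if "0 < x" "x \<le> y" "y < 1" for x y
    using hurwitz_beta_antimono[of "beta_inv x" "beta_inv y"] beta_inv[of x] beta_inv[of y] that by force
qed (use assms in auto)

section \<open>Derivatives and smoothness of the zero and its inverse\<close>

lemma hurwitz_reg_hurwitz_beta: "0 < a \<Longrightarrow> a < 1 / 2 \<Longrightarrow> hurwitz_reg (of_real (hurwitz_beta a), of_real a) = 0"
  using hurwitz_reg_of_real[of "hurwitz_beta a" a] hurwitz_beta[of a] by simp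

lemma partial_fst_hurwitz_reg_hurwitz_beta: "0 < a \<Longrightarrow> a < 1 / 2 \<Longrightarrow> partial_fst hurwitz_reg (of_real (hurwitz_beta a), of_real a) \<noteq> 0"
  using partial_fst_hurwitz_reg_nonzero[of "hurwitz_beta a" a] hurwitz_beta[of a] by simp

lemma partial_snd_hurwitz_reg_hurwitz_beta: "0 < a \<Longrightarrow> a < 1 / 2 \<Longrightarrow> partial_snd hurwitz_reg (of_real (hurwitz_beta a), of_real a) \<noteq> 0"
  using partial_snd_hurwitz_reg_nonzero[of "hurwitz_beta a" a] hurwitz_beta[of a] by simp

text \<open>Existence comes from the implicit function lemma; the value is read off by
  differentiating \<open>hurwitz_reg (hurwitz_beta t, t) = 0\<close>. The nonzero partial derivative
  in the parameter gives \<open>d \<noteq> 0\<close>, which the inverse function requires.\<close>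

lemma hurwitz_beta_derivative:
  assumes a: "0 < a" "a < 1 / 2"
  obtains d where "(hurwitz_beta has_real_derivative d) (at a)"
    "of_real d = - partial_snd hurwitz_reg (of_real (hurwitz_beta a), of_real a) / partial_fst hurwitz_reg (of_real (hurwitz_beta a), of_real a)"
    "d \<noteq> 0"
proof -
  let ?p = "(complex_of_real (hurwitz_beta a), complex_of_real a)"
  have ev: "\<forall>\<^sub>F t in nhds a. t \<in> {0<..<1/2}" using a by (intro eventually_nhds_in_open) auto
  have "\<exists>d. (hurwitz_beta has_real_derivative d) (at a)"
  proof (rule implicit_function_differentiable)
    show "(hurwitz_reg has_derivative (\<lambda>q. partial_fst hurwitz_reg ?p * fst q + partial_snd hurwitz_reg ?p * snd q)) (at ?p)"
      using a by (intro sep_hol_has_derivative[OF sep_hol_hurwitz_reg]) auto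
    show "\<forall>\<^sub>F t in nhds a. hurwitz_reg (of_real (hurwitz_beta t), of_real t) = 0"
      using ev by eventually_elim (simp add: hurwitz_reg_hurwitz_beta)
  qed (use a partial_fst_hurwitz_reg_hurwitz_beta isCont_hurwitz_beta in auto)
  then obtain d where d: "(hurwitz_beta has_real_derivative d) (at a)" by blast
  have "((\<lambda>t. hurwitz_reg (of_real (hurwitz_beta t), of_real t)) has_vector_derivative (partial_fst hurwitz_reg ?p * of_real d + partial_snd hurwitz_reg ?p * of_real 1)) (at a)"
    using a by (intro hurwitz_reg_real_derivative d) auto
  moreover have "((\<lambda>t. hurwitz_reg (of_real (hurwitz_beta t), of_real t)) has_vector_derivative 0) (at a)"
    by (rule has_vector_derivative_transform_within_open[of "\<lambda>_. 0" _ _ "{0<..<1/2}"])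
      (use a hurwitz_reg_hurwitz_beta in auto)
  ultimately have e: "partial_fst hurwitz_reg ?p * of_real d + partial_snd hurwitz_reg ?p = 0"
    using vector_derivative_unique_at by fastforce
  then have "of_real d = - partial_snd hurwitz_reg ?p / partial_fst hurwitz_reg ?p"
    using partial_fst_hurwitz_reg_hurwitz_beta[OF a] by (simp add: field_simps add_eq_0_iff2)
  moreover have "d \<noteq> 0" using e partial_snd_hurwitz_reg_hurwitz_beta[OF a] by auto
  ultimately show ?thesis using that d by blast
qed

lemma beta_inv_derivative:
  assumes s: "0 < s" "s < 1"
  obtains d where "(beta_inv has_real_derivative d) (at s)"
    "of_real d = - partial_fst hurwitz_reg (of_real s, of_real (beta_inv s)) / partial_snd hurwitz_reg (of_real s, of_real (beta_inv s))"
proof -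
  note h = beta_inv[OF s]
  obtain d where d: "(hurwitz_beta has_real_derivative d) (at (beta_inv s))"
    "of_real d = - partial_snd hurwitz_reg (of_real (hurwitz_beta (beta_inv s)), of_real (beta_inv s)) / partial_fst hurwitz_reg (of_real (hurwitz_beta (beta_inv s)), of_real (beta_inv s))"
    "d \<noteq> 0"
    using hurwitz_beta_derivative[OF h(1,2)] .
  have "(beta_inv has_real_derivative inverse d) (at s)"
    by (rule DERIV_inverse_function[where f = hurwitz_beta and g = beta_inv and a = 0 and b = 1, OF d(1) d(3) s]) (use beta_inv isCont_beta_inv s in auto)
  moreover have "of_real (inverse d) = - partial_fst hurwitz_reg (of_real s, of_real (beta_inv s)) / partial_snd hurwitz_reg (of_real s, of_real (beta_inv s))"
    using d(2) h by simp
  ultimately show ?thesis using that by blast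
qed

lemma sep_hol_nonzero:
  assumes "sep_hol W f" "sep_hol W g"
  shows "sep_hol {p \<in> W. g p \<noteq> 0} f"
proof (rule sep_hol_subset[OF assms(1)])
  have "open (W \<inter> g -` (- {0}))"
    using assms(2) unfolding sep_hol_def by (intro continuous_open_preimage) auto
  also have "W \<inter> g -` (- {0}) = {p \<in> W. g p \<noteq> 0}" by auto
  finally show "open {p \<in> W. g p \<noteq> 0}" .
qed auto

text \<open>With \<open>F = hurwitz_reg\<close>, the curve \<open>(hurwitz_beta t, t)\<close>
  follows the field \<open>(- F_w / F_s, 1)\<close> on the open set where the denominator is
  nonzero. For the inverse the curve is \<open>(t, beta_inv t)\<close> and the field is
  \<open>(1, - F_s / F_w)\<close>.\<close>

lemma smooth_on_hurwitz_beta: "smooth_on {0<..<1/2} hurwitz_beta"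
proof -
  let ?U = "UNIV \<times> {w. Re w > 0}"
  let ?W = "{p \<in> ?U. partial_fst hurwitz_reg p \<noteq> 0}"
  have sh: "sep_hol ?W f" if "sep_hol ?U f" for f
    using sep_hol_nonzero[OF that sep_hol_partial_fst[OF sep_hol_hurwitz_reg]] .
  have oW: "open ?W" using sh[OF sep_hol_hurwitz_reg] by (simp add: sep_hol_def)
  have "smooth_on {0<..<1/2} (\<lambda>t. Re (fst (complex_of_real (hurwitz_beta t), complex_of_real t)))"
  proof (rule smooth_on_sep_hol_curve[where x = hurwitz_beta and y = "\<lambda>t. t"])
    show "sep_hol ?W (\<lambda>p. - partial_snd hurwitz_reg p / partial_fst hurwitz_reg p)"
      by (intro sep_hol_divide sep_hol_uminus sh sep_hol_partial_fst sep_hol_partial_snd sep_hol_hurwitz_reg) auto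
    show "sep_hol ?W (\<lambda>_. 1)" "sep_hol ?W fst" using oW by (auto intro: sep_hol_const sep_hol_fst)
    fix t :: real assume t: "t \<in> {0<..<1/2}"
    then show "(complex_of_real (hurwitz_beta t), complex_of_real t) \<in> ?W" using partial_fst_hurwitz_reg_hurwitz_beta by auto
    show "\<exists>d. (hurwitz_beta has_real_derivative d) (at t) \<and> of_real d =
        - partial_snd hurwitz_reg (of_real (hurwitz_beta t), of_real t) / partial_fst hurwitz_reg (of_real (hurwitz_beta t), of_real t)"
      using hurwitz_beta_derivative[of t] t by auto
    show "\<exists>d. ((\<lambda>t. t) has_real_derivative d) (at t) \<and> complex_of_real d = 1"
      by (intro exI[of _ 1]) auto
  qed simp
  then show ?thesis by simp
qed

lemma smooth_on_beta_inv: "smooth_on {0<..<1} beta_inv"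
proof -
  let ?U = "UNIV \<times> {w. Re w > 0}"
  let ?W = "{p \<in> ?U. partial_snd hurwitz_reg p \<noteq> 0}"
  have sh: "sep_hol ?W f" if "sep_hol ?U f" for f
    using sep_hol_nonzero[OF that sep_hol_partial_snd[OF sep_hol_hurwitz_reg]] .
  have oW: "open ?W" using sh[OF sep_hol_hurwitz_reg] by (simp add: sep_hol_def)
  have "smooth_on {0<..<1} (\<lambda>t. Re (snd (complex_of_real t, complex_of_real (beta_inv t))))"
  proof (rule smooth_on_sep_hol_curve[where x = "\<lambda>t. t" and y = beta_inv])
    show "sep_hol ?W (\<lambda>_. 1)" using oW by (auto intro: sep_hol_const)
    show "sep_hol ?W (\<lambda>p. - partial_fst hurwitz_reg p / partial_snd hurwitz_reg p)"
      by (intro sep_hol_divide sep_hol_uminus sh sep_hol_partial_fst sep_hol_partial_snd sep_hol_hurwitz_reg) auto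
    show "sep_hol ?W snd" using oW by (auto intro: sep_hol_snd)
    fix t :: real assume t: "t \<in> {0<..<1}"
    then show "(complex_of_real t, complex_of_real (beta_inv t)) \<in> ?W"
      using partial_snd_hurwitz_reg_nonzero[of t "beta_inv t"] beta_inv[of t] by auto
    show "\<exists>d. (beta_inv has_real_derivative d) (at t) \<and> of_real d =
        - partial_fst hurwitz_reg (of_real t, of_real (beta_inv t)) / partial_snd hurwitz_reg (of_real t, of_real (beta_inv t))"
      using beta_inv_derivative[of t] t by auto
    show "\<exists>d. ((\<lambda>t. t) has_real_derivative d) (at t) \<and> complex_of_real d = 1"
      by (intro exI[of _ 1]) auto
  qed simp
  then show ?thesis by simp
qed

lemma zorder_hurwitz_zeta:
  assumes a: "0 < a" "a < 1 / 2" and s: "0 < s" "s < 1" and zero: "hurwitz_zeta a (of_real s) = 0"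
  shows "zorder (hurwitz_zeta a) (of_real s) = 1"
proof -
  have real_hurwitz: "real_hurwitz s a = 0" using zero hurwitz_zeta_of_real[OF s a(1)] by simp
  let ?s = "complex_of_real s"
  have s1: "?s \<noteq> 1" using s by simp
  have hol: "(\<lambda>z. hurwitz_reg (z, of_real a)) holomorphic_on UNIV"
    by (rule sep_hol_box(1)[OF sep_hol_hurwitz_reg, where V = "{w. Re w > 0}"]) (use a open_right_half in auto)
  have eq: "hurwitz_zeta a z = hurwitz_reg (z, of_real a) / (z - 1)" if "z \<in> - {1}" for z
    using that hurwitz_zeta_eq[OF a(1), of z] by simp
  have "(\<lambda>z. hurwitz_reg (z, of_real a) / (z - 1)) holomorphic_on - {1}"
    by (intro holomorphic_intros) (auto intro: holomorphic_on_subset[OF hol])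
  then have hz: "hurwitz_zeta a holomorphic_on - {1}"
    by (rule holomorphic_transform) (simp add: eq)
  have "((\<lambda>z. hurwitz_reg (z, of_real a)) has_field_derivative partial_fst hurwitz_reg (?s, of_real a)) (at ?s)"
    using hol by (simp add: partial_fst_def holomorphic_derivI)
  moreover have "((\<lambda>z. z - 1) has_field_derivative 1) (at ?s)"
    by (auto intro!: derivative_eq_intros)
  ultimately have "((\<lambda>z. hurwitz_reg (z, of_real a) / (z - 1)) has_field_derivative
     (partial_fst hurwitz_reg (?s, of_real a) * (?s - 1) - hurwitz_reg (?s, of_real a) * 1) / ((?s - 1) * (?s - 1))) (at ?s)"
    by (rule DERIV_divide) (use s1 in simp)
  moreover have "hurwitz_reg (?s, of_real a) = 0" using real_hurwitz hurwitz_reg_of_real[OF s a(1)] by simp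
  ultimately have "((\<lambda>z. hurwitz_reg (z, of_real a) / (z - 1)) has_field_derivative partial_fst hurwitz_reg (?s, of_real a) / (?s - 1)) (at ?s)"
    using s1 by simp
  then have d: "(hurwitz_zeta a has_field_derivative partial_fst hurwitz_reg (?s, of_real a) / (?s - 1)) (at ?s)"
    by (rule has_field_derivative_transform_within_open[of _ _ _ "- {1}"]) (use s1 eq in auto)
  then have "deriv (hurwitz_zeta a) ?s \<noteq> 0"
    using partial_fst_hurwitz_reg_nonzero[OF s a real_hurwitz] s1 by (simp add: DERIV_imp_deriv)
  then show ?thesis
    using zorder_zero_eqI[OF hz, of ?s 1] s1 zero by auto
qed


section \<open>Behaviour of the zero near parameter 0\<close>


text \<open>Clearing the denominator \<open>\<delta>\<close> in the decomposition gives
  \<open>\<delta> = a powr (1 - \<delta>) * (P - \<delta> * T)\<close>. Both \<open>P - 1\<close>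
  and \<open>\<delta> * T\<close> lie between 0 and \<open>\<delta>\<close>, so their difference
  \<open>E\<close> is at most \<open>\<delta>\<close> in absolute value.\<close>

lemma hurwitz_beta_equation:
  assumes a: "0 < a" "a < 1 / 2"
  defines "\<delta> \<equiv> 1 - hurwitz_beta a"
  obtains E where "\<bar>E\<bar> \<le> \<delta>" "\<delta> = a * exp (\<delta> * (- ln a)) * (1 + E)"
proof -
  note b = hurwitz_beta[OF a]
  have \<delta>: "0 < \<delta>" "\<delta> < 1" "hurwitz_beta a = 1 - \<delta>" using b by (auto simp: \<delta>_def)
  obtain T where T: "0 \<le> T" "T \<le> 1"
    "real_hurwitz (hurwitz_beta a) a = a powr (- hurwitz_beta a) - (a + 1) powr (1 - hurwitz_beta a) / (1 - hurwitz_beta a) + T"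
    using real_hurwitz_decompose[OF b(1,2) a(1)] .
  define P where "P = (a + 1) powr \<delta>"
  have P: "P = \<delta> * (a powr (\<delta> - 1) + T)"
    using T(3) b(3) \<delta> by (simp add: P_def field_simps)
  have "1 \<le> P" unfolding P_def using a \<delta> by (intro ge_one_powr_ge_zero) auto
  moreover have "P \<le> 1 + \<delta> * a"
  proof -
    \<comment> \<open>Bernoulli's inequality as a weighted mean inequality, with the dummy factor
      \<open>1 powr (1 - \<delta>)\<close>.\<close>
    have "P = (1 + a) powr \<delta> * 1 powr (1 - \<delta>)" by (simp add: P_def add.commute)
    also have "\<dots> \<le> \<delta> * (1 + a) + (1 - \<delta>) * 1"
      using a \<delta> by (intro Youngs_inequality_0) auto
    finally show ?thesis by (simp add: algebra_simps)
  qed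
  moreover have "\<delta> * a \<le> \<delta> * 1" using a \<delta> by (intro mult_left_mono) auto
  moreover have "0 \<le> \<delta> * T" "\<delta> * T \<le> \<delta> * 1" using T \<delta> by (auto intro!: mult_left_mono)
  ultimately have E: "\<bar>P - \<delta> * T - 1\<bar> \<le> \<delta>" by linarith
  have "a powr (1 - \<delta>) * a powr (\<delta> - 1) = 1" using a by (simp flip: powr_add)
  then have "\<delta> = a powr (1 - \<delta>) * (P - \<delta> * T)"
    unfolding P by (simp add: algebra_simps)
  also have "a powr (1 - \<delta>) = a * exp (\<delta> * (- ln a))"
    using a by (simp add: powr_def left_diff_distrib exp_diff exp_minus field_simps)
  finally have "\<delta> = a * exp (\<delta> * (- ln a)) * (1 + (P - \<delta> * T - 1))" by simp
  then show ?thesis using that E by blast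
qed

text \<open>Each bound on \<open>\<delta>\<close> improves the next: \<open>\<delta> < 1/4\<close>
  gives \<open>\<delta> \<le> 2 * a powr (3/4)\<close>, hence \<open>\<delta> * L \<le> 1\<close>,
  hence \<open>\<delta> \<le> 4 * a\<close>. Then \<open>exp x\<close> is expanded to first order
  for \<open>x = \<delta> * L\<close>, and finally \<open>x\<close> is replaced by
  \<open>a * L\<close>.\<close>

lemma hurwitz_beta_asymptotic:
  "(\<lambda>a. hurwitz_beta a - (1 - a + a\<^sup>2 * ln a)) \<in> O[at_right 0](\<lambda>a. a\<^sup>2)"
proof (rule bigoI)
  \<comment> \<open>Below this parameter the zero exceeds \<open>3/4\<close>, which starts the chain
    with \<open>\<delta> < 1/4\<close>.\<close>
  have "0 < beta_inv (3 / 4)" using beta_inv(1)[of "3/4"] by simp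
  then have "\<forall>\<^sub>F a in at_right 0. a < beta_inv (3 / 4)"
    by (rule order_tendstoD(2)[OF tendsto_ident_at])
  moreover have "\<forall>\<^sub>F a::real in at_right 0. 0 < a" by (simp add: eventually_at_filter)
  moreover have "\<forall>\<^sub>F a::real in at_right 0. 2 * a powr (3 / 4) * (- ln a) \<le> 1" by real_asymp
  moreover have "\<forall>\<^sub>F a::real in at_right 0. a * (- ln a) \<le> 1" by real_asymp
  moreover have "\<forall>\<^sub>F a::real in at_right 0. a * (- ln a)\<^sup>2 \<le> 1" by real_asymp
  ultimately show "\<forall>\<^sub>F a in at_right 0. norm (hurwitz_beta a - (1 - a + a\<^sup>2 * ln a)) \<le> 60 * norm (a\<^sup>2)"
  proof eventually_elim
    case (elim a)
    have ah: "a < 1 / 2" using elim(1) beta_inv(2)[of "3/4"] by simp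
    define L where "L = - ln a"
    have L: "L > 0" using elim(2) ah by (simp add: L_def)
    define \<delta> where "\<delta> = 1 - hurwitz_beta a"
    have \<delta>0: "\<delta> > 0" using hurwitz_beta[OF elim(2) ah] by (simp add: \<delta>_def)
    have "hurwitz_beta (beta_inv (3 / 4)) < hurwitz_beta a"
      using elim(1,2) beta_inv(2)[of "3/4"] by (intro hurwitz_beta_antimono) auto
    then have \<delta>1: "\<delta> < 1 / 4" using beta_inv(3)[of "3/4"] by (simp add: \<delta>_def)
    obtain E where E: "\<bar>E\<bar> \<le> \<delta>" "\<delta> = a * exp (\<delta> * L) * (1 + E)"
      using hurwitz_beta_equation[OF elim(2) ah] unfolding \<delta>_def L_def by blast
    have "a * exp (\<delta> * L) = a powr (1 - \<delta>)"
      using elim(2) by (simp add: L_def powr_def left_diff_distrib exp_diff exp_minus field_simps)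
    also have "\<dots> \<le> a powr (3 / 4)" using elim(2) ah \<delta>1 by (intro powr_mono') auto
    finally have "a * exp (\<delta> * L) * (1 + E) \<le> a powr (3 / 4) * 2"
      using E(1) \<delta>1 by (intro mult_mono) auto
    then have "\<delta> \<le> 2 * a powr (3 / 4)" using E(2) by simp
    then have "\<delta> * L \<le> 2 * a powr (3 / 4) * L" using L by (intro mult_right_mono) auto
    then have x1: "\<delta> * L \<le> 1" using elim(3) by (simp add: L_def)
    define x where "x = \<delta> * L"
    have x: "0 \<le> x" "x \<le> 1" using x1 \<delta>0 L by (auto simp: x_def)
    have ex: "1 + x \<le> exp x" "exp x \<le> 1 + x + x\<^sup>2" "exp x \<le> 3"
      using exp_ge_add_one_self[of x] exp_bound[OF x] exp_le x by (auto intro: order_trans[of _ "exp 1"])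
    have "exp x * (1 + E) \<le> 3 * (5 / 4)" using ex E(1) \<delta>1 by (intro mult_mono) auto
    then have "a * (exp x * (1 + E)) \<le> a * 4" using elim(2) by (intro mult_left_mono) auto
    then have d4: "\<delta> \<le> 4 * a" using E(2) by (simp add: x_def mult_ac)
    have x4: "x \<le> 4 * (a * L)" using mult_right_mono[OF d4, of L] L by (simp add: x_def mult_ac)
    have aL: "a * L \<le> 1" "a * L\<^sup>2 \<le> 1" "0 \<le> a * L"
      using elim(4,5) mult_pos_pos[OF elim(2) L] by (auto simp: L_def)
    have x2: "x\<^sup>2 \<le> 16 * a"
    proof -
      have "x\<^sup>2 \<le> (4 * (a * L))\<^sup>2" using x4 x by (intro power_mono)
      also have "\<dots> = 16 * a * (a * L\<^sup>2)" by (simp add: power2_eq_square)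
      also have "\<dots> \<le> 16 * a * 1" using aL elim(2) by (intro mult_left_mono) auto
      finally show ?thesis by simp
    qed
    have "\<bar>exp x * E\<bar> \<le> 3 * (4 * a)" unfolding abs_mult using ex E(1) d4 by (intro mult_mono) auto
    \<comment> \<open>Here 28 = 16 + 12: the remainder of \<open>exp x\<close> is at most
      \<open>x\<^sup>2 \<le> 16 * a\<close>, and \<open>exp x * E\<close> contributes at most
      \<open>12 * a\<close>.\<close>
    then have "\<bar>exp x * (1 + E) - 1 - x\<bar> \<le> 28 * a"
      unfolding distrib_left[of "exp x"] mult_1_right using ex x2 by linarith
    then have "a * \<bar>exp x * (1 + E) - 1 - x\<bar> \<le> a * (28 * a)" using elim(2) by (intro mult_left_mono) auto
    moreover have "\<delta> - a * (1 + x) = a * (exp x * (1 + E) - 1 - x)"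
      using E(2) by (simp add: x_def algebra_simps)
    ultimately have 1: "\<bar>\<delta> - a * (1 + x)\<bar> \<le> 28 * a\<^sup>2"
      using elim(2) by (simp add: abs_mult power2_eq_square mult_ac)
    have ax: "a * x \<le> a * (4 * (a * L))" using x4 elim(2) by (intro mult_left_mono) auto
    have "\<bar>\<delta> - a\<bar> \<le> 28 * a\<^sup>2 + 4 * a\<^sup>2 * L"
    proof -
      have "\<delta> - a = (\<delta> - a * (1 + x)) + a * x" by (simp add: algebra_simps)
      moreover have "0 \<le> a * x" using elim(2) x by simp
      ultimately show ?thesis using 1 ax by (simp add: power2_eq_square mult_ac)
    qed
    \<comment> \<open>Replacing \<open>\<delta>\<close> by \<open>a\<close> in \<open>x\<close>
      costs \<open>a * L * |\<delta> - a|\<close>. The logarithms are absorbed by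
      \<open>a * L \<le> 1\<close> and \<open>a * L\<^sup>2 \<le> 1\<close>, so the cost is 28 + 4 =
      32, and the total constant is 28 + 32 = 60.\<close>
    then have "(a * L) * \<bar>\<delta> - a\<bar> \<le> (a * L) * (28 * a\<^sup>2 + 4 * a\<^sup>2 * L)" using aL by (intro mult_left_mono)
    also have "\<dots> = 28 * a\<^sup>2 * (a * L) + 4 * a\<^sup>2 * (a * L\<^sup>2)" by (simp add: power2_eq_square algebra_simps)
    also have "\<dots> \<le> 28 * a\<^sup>2 * 1 + 4 * a\<^sup>2 * 1" using aL by (intro add_mono mult_left_mono) auto
    finally have "(a * L) * \<bar>\<delta> - a\<bar> \<le> 32 * a\<^sup>2" by simp
    moreover have "\<bar>a * x - a * (a * L)\<bar> = (a * L) * \<bar>\<delta> - a\<bar>"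
    proof -
      have "a * x - a * (a * L) = (a * L) * (\<delta> - a)" by (simp add: x_def algebra_simps)
      then show ?thesis using aL(3) by (simp only: abs_mult[of "a * L"] abs_of_nonneg)
    qed
    ultimately have 2: "\<bar>a * x - a * (a * L)\<bar> \<le> 32 * a\<^sup>2" by simp
    have "hurwitz_beta a - (1 - a + a\<^sup>2 * ln a) = - ((\<delta> - a * (1 + x)) + (a * x - a * (a * L)))"
      by (simp add: \<delta>_def L_def power2_eq_square algebra_simps)
    then have "\<bar>hurwitz_beta a - (1 - a + a\<^sup>2 * ln a)\<bar> \<le> 60 * a\<^sup>2"
      using 1 2 by linarith
    then show ?case by simp
  qed
qed

theorem theorem1p2:
  shows "(\<forall>a\<in>{0<..<1/2::real}.
            (\<exists>!\<sigma>::real. \<sigma> \<in> {0<..<1} \<and> hurwitz_zeta a (of_real \<sigma>) = 0) \<and>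
            (\<forall>\<sigma>\<in>{0<..<1::real}. hurwitz_zeta a (of_real \<sigma>) = 0 \<longrightarrow>
               zorder (hurwitz_zeta a) (of_real \<sigma>) = 1)) \<and>
         smooth_diffeomorphism hurwitz_beta {0<..<1/2} {0<..<1} \<and>
         strict_antimono_on {0<..<1/2} hurwitz_beta \<and>
         (\<lambda>a. hurwitz_beta a - (1 - a + a\<^sup>2 * ln a)) \<in> O[at_right 0](\<lambda>a. a\<^sup>2)"
proof (intro conjI ballI impI hurwitz_beta_asymptotic)
  fix a :: real assume a: "a \<in> {0<..<1/2}"
  show "\<exists>!\<sigma>::real. \<sigma> \<in> {0<..<1} \<and> hurwitz_zeta a (of_real \<sigma>) = 0"
  proof (rule ex1I[of _ "hurwitz_beta a"])
    show "hurwitz_beta a \<in> {0<..<1} \<and> hurwitz_zeta a (of_real (hurwitz_beta a)) = 0"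
      using hurwitz_beta[of a] a by (simp add: hurwitz_zeta_of_real)
    show "\<sigma> = hurwitz_beta a" if "\<sigma> \<in> {0<..<1} \<and> hurwitz_zeta a (of_real \<sigma>) = 0" for \<sigma>
      using hurwitz_beta_eqI[of a \<sigma>] that a hurwitz_zeta_of_real[of \<sigma> a] by auto
  qed
  show "zorder (hurwitz_zeta a) (of_real \<sigma>) = 1"
    if "\<sigma> \<in> {0<..<1}" "hurwitz_zeta a (of_real \<sigma>) = 0" for \<sigma>
    using zorder_hurwitz_zeta[of a \<sigma>] a that by simp
next
  show "smooth_diffeomorphism hurwitz_beta {0<..<1/2} {0<..<1}"
    unfolding smooth_diffeomorphism_def
    using bij_hurwitz_beta smooth_on_hurwitz_beta smooth_on_beta_inv by simp
  show "strict_antimono_on {0<..<1/2} hurwitz_beta"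
    using hurwitz_beta_antimono by (intro monotone_onI) auto
qed

end
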